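(* Let $\mathcal H$ be a real Hilbert space and let $A:\mathcal H\to2^{\mathcal H}$ be a maximally monotone operator whose set of zeros $\operatorname{zer}A=\{z\in\mathcal H:0\in Az\}$ is nonempty. Let $\alpha>1$, $\beta>0$, $0<\sigma<\alpha-1$, $t_0>0$, and let $\delta,\gamma:[t_0,+\infty)\to(0,+\infty)$ be $C^1$ functions such that: (a) the limit $\lim_{t\to+\infty}\frac{\gamma(t)}{t^2\delta(t)}$ exists as a real number and satisfies $\lim_{t\to+\infty}\frac{\gamma(t)}{t^2\delta(t)}>\frac{1}{4(\alpha-\sigma-1)\sigma}$; (b) there exists $M>0$ such that $0<\frac{t\dot\delta(t)}{\delta(t)}\le M$ for all sufficiently large $t$; (c) $\frac{|\dot\gamma(t)|}{\gamma(t)}=O(1/t)$ as $t\to+\infty$. Let $x:[t_0,+\infty)\to\mathcal H$ be any solution trajectory of $$\ddot x(t)+\frac{\alpha}{t}\dot x(t)+\beta\,\frac{\mathrm d}{\mathrm dt}\Big[\delta(t)A_{\gamma(t)}(x(t))\Big]+\Big(1+\frac{\beta}{t}\Big)\delta(t)A_{\gamma(t)}(x(t))=0 .$$ Then, as $t\to+\infty$: (i) $\|A_{\gamma(t)}(x(t))\|=o\big(\frac1{t^2\delta(t)}\big)$; (ii) $\|\dot x(t)\|=o\big(\frac1t\big)$; (iii) $\int_{t_0}^{+\infty}t\|\dot x(t)\|^2\,\mathrm dt<+\infty$; (iv) $\int_{t_0}^{+\infty}t^3\delta(t)^2\|A_{\gamma(t)}(x(t))\|^2\,\mathrm dt<+\infty$;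 (v) $x(t)$ converges weakly as $t\to+\infty$, and its limit is a zero of $A$.
   Context: For $\lambda>0$, the resolvent of $A$ is $J_{\lambda A}=(I+\lambda A)^{-1}$ (everywhere defined and single-valued), and the Yosida approximation of $A$ is the single-valued operator $A_\lambda=\frac1\lambda(I-J_{\lambda A}):\mathcal H\to\mathcal H$. It is $\frac1\lambda$-Lipschitz and $\lambda$-cocoercive. Solution convention: a solution trajectory is a $C^1$ function $x:[t_0,+\infty)\to\mathcal H$ with $\dot x$ locally absolutely continuous, satisfying the equation for almost every $t\ge t_0$. *)

theory Defs
  imports "HOL-Analysis.Analysis" "HOL-Library.Landau_Symbols"
begin

text \<open>A set-valued operator is a function \<open>A :: 'a \<Rightarrow> 'a set\<close>; its graph is \<open>{(x, u). u \<in> A x}\<close>.\<close>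

definition monotone_operator :: "('a::real_inner \<Rightarrow> 'a set) \<Rightarrow> bool" where
  "monotone_operator A \<longleftrightarrow>
     (\<forall>x y u v. u \<in> A x \<longrightarrow> v \<in> A y \<longrightarrow> 0 \<le> (x - y) \<bullet> (u - v))"

definition maximally_monotone :: "('a::real_inner \<Rightarrow> 'a set) \<Rightarrow> bool" where
  "maximally_monotone A \<longleftrightarrow>
     monotone_operator A \<and>
     (\<forall>B. monotone_operator B \<longrightarrow> (\<forall>x. A x \<subseteq> B x) \<longrightarrow> B = A)"

definition zer :: "('a::real_inner \<Rightarrow> 'a set) \<Rightarrow> 'a set" where
  "zer A = {z. 0 \<in> A z}"

text \<open>\<open>resolvent lam A u\<close> is the point \<open>y\<close> with \<open>u \<in> (I + lam A) y\<close>. It is well defined by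
  \<open>THE\<close> for \<open>lam > 0\<close> and maximally monotone \<open>A\<close> on a Hilbert space, by Minty's theorem.\<close>

definition resolvent :: "real \<Rightarrow> ('a::real_inner \<Rightarrow> 'a set) \<Rightarrow> 'a \<Rightarrow> 'a" where
  "resolvent lam A u = (THE y. u \<in> (\<lambda>a. y + lam *\<^sub>R a) ` A y)"

definition yosida :: "('a::real_inner \<Rightarrow> 'a set) \<Rightarrow> real \<Rightarrow> 'a \<Rightarrow> 'a" where
  "yosida A lam u = (1 / lam) *\<^sub>R (u - resolvent lam A u)"

text \<open>\<open>f\<close> is \<open>C\<^sup>1\<close> on \<open>[t0, \<infinity>)\<close> with derivative \<open>f'\<close>. The derivative at \<open>t0\<close> is one-sided, so
  this differs from \<^const>\<open>C1_differentiable_on\<close>, and values left of \<open>t0\<close> are irrelevant.\<close>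

definition C1_from :: "real \<Rightarrow> (real \<Rightarrow> 'a::real_normed_vector) \<Rightarrow> (real \<Rightarrow> 'a) \<Rightarrow> bool" where
  "C1_from t0 f f' \<longleftrightarrow>
     (\<forall>t\<ge>t0. (f has_vector_derivative f' t) (at t within {t0..})) \<and> continuous_on {t0..} f'"

definition absolutely_continuous_fun ::
    "real \<Rightarrow> real \<Rightarrow> (real \<Rightarrow> 'a::real_normed_vector) \<Rightarrow> bool" where
  "absolutely_continuous_fun a b f \<longleftrightarrow>
     (\<forall>e>0. \<exists>d>0. \<forall>(n::nat) l r.
        (\<forall>i<n. a \<le> l i \<and> l i \<le> r i \<and> r i \<le> b) \<longrightarrow>
        disjoint_family_on (\<lambda>i. {l i<..<r i}) {..<n} \<longrightarrow>
        (\<Sum>i<n. r i - l i) < d \<longrightarrow>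
        (\<Sum>i<n. norm (f (r i) - f (l i))) < e)"

definition locally_absolutely_continuous_from ::
    "real \<Rightarrow> (real \<Rightarrow> 'a::real_normed_vector) \<Rightarrow> bool" where
  "locally_absolutely_continuous_from t0 f \<longleftrightarrow>
     (\<forall>a b. t0 \<le> a \<longrightarrow> a \<le> b \<longrightarrow> absolutely_continuous_fun a b f)"

text \<open>\<open>x'\<close> is the derivative of \<open>x\<close>. At almost every \<open>t\<close>, the derivatives occurring in the
  equation (\<open>x2\<close> of \<open>x'\<close>, and \<open>D\<close> of \<open>\<delta>(t) A\<^bsub>\<gamma>(t)\<^esub>(x(t))\<close>) exist and the equation holds.\<close>

definition solution_trajectory ::
    "('a::{real_inner,complete_space} \<Rightarrow> 'a set) \<Rightarrow> real \<Rightarrow> real \<Rightarrow> (real \<Rightarrow> real) \<Rightarrow> (real \<Rightarrow> real)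
      \<Rightarrow> real \<Rightarrow> (real \<Rightarrow> 'a) \<Rightarrow> (real \<Rightarrow> 'a) \<Rightarrow> bool" where
  "solution_trajectory A \<alpha> \<beta> \<delta> \<gamma> t0 x x' \<longleftrightarrow>
     C1_from t0 x x' \<and> locally_absolutely_continuous_from t0 x' \<and>
     (AE t in lborel. t0 \<le> t \<longrightarrow>
        (\<exists>x2 D. (x' has_vector_derivative x2) (at t within {t0..}) \<and>
           ((\<lambda>s. \<delta> s *\<^sub>R yosida A (\<gamma> s) (x s)) has_vector_derivative D) (at t within {t0..}) \<and>
           x2 + (\<alpha> / t) *\<^sub>R x' t + \<beta> *\<^sub>R D
             + ((1 + \<beta> / t) * \<delta> t) *\<^sub>R yosida A (\<gamma> t) (x t) = 0))"

definition converges_weakly :: "(real \<Rightarrow> 'a::real_inner) \<Rightarrow> 'a \<Rightarrow> bool" where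
  "converges_weakly x z \<longleftrightarrow> (\<forall>u. ((\<lambda>t. x t \<bullet> u) \<longlongrightarrow> z \<bullet> u) at_top)"

end

theory Submission
  imports Defs
begin

text \<open>Write \<open>a(t) = A\<^bsub>\<gamma>(t)\<^esub>(x(t))\<close>, \<open>p = \<delta> a\<close> and \<open>w = t (x' + \<beta> p)\<close>. The equation says
  \<open>w' = (1 - \<alpha>) x' - t p\<close>, and \<open>w\<close> is \<open>C\<^sup>1\<close>. For a zero \<open>z\<close> of \<open>A\<close>, the energy
  \<open>|\<sigma>(x - z) + w|\<^sup>2/2 + \<sigma>(\<alpha> - \<sigma> - 1)|x - z|\<^sup>2/2\<close> has a derivative which, since cocoercivity gives
  \<open>\<langle>x - z, p\<rangle> \<ge> (\<gamma>/\<delta>)|p|\<^sup>2\<close>, is bounded by a quadratic form in \<open>(x', t p)\<close>; the hypothesis on the limit of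
  \<open>\<gamma>/(t\<^sup>2\<delta>)\<close> makes it at most \<open>-\<epsilon> q\<close> with \<open>q = t|x'|\<^sup>2 + t\<^sup>3|p|\<^sup>2\<close>. Hence \<open>q\<close> is integrable, the energy
  converges and \<open>x\<close> is bounded. Both \<open>f = t\<^sup>4|p|\<^sup>2\<close> and \<open>f = |w|\<^sup>2\<close> satisfy \<open>f' \<le> C q\<close> and \<open>f/t \<le> K q\<close>, so
  they have a limit, which is \<open>0\<close> because \<open>1/t\<close> is not integrable. Then \<open>|x - z|\<close> converges, and weak
  convergence follows by an Opial argument for the nonexpansive resolvent. That argument runs on asymptotic
  centers, and Minty's theorem is obtained by a convex duality on finite parts of the graph, so
  no weak compactness is needed.\<close>

section \<open>Minty's theorem and the Yosida approximation\<close>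

text \<open>Everything about \<open>yosida\<close> rests on the \<open>THE\<close> in
  \<open>resolvent\<close>, so existence and uniqueness of that point are needed before
  \<open>yosida\<close> can be estimated at all. The second obstacle is regularity: \<open>a\<close>
  depends on its index and its point only in a Lipschitz way, so \<open>p\<close> and
  \<open>x'\<close> are merely absolutely continuous, and the derivative of \<open>p\<close> is
  given only off a null set. The decrease of quantities built from \<open>p\<close>, and the
  differentiability of \<open>w\<close>, therefore go through a gauge argument for absolutely
  continuous real functions. The bound \<open>f' \<le> C q\<close> for
  \<open>f = t\<^sup>4|p|\<^sup>2\<close> comes from the parameters: the logarithmic derivatives of
  \<delta> and \<gamma> are O(1/t), and \<gamma> is at least a multiple of
  \<open>t\<^sup>2\<delta>\<close>, so \<open>|p'|\<close> is at most of order
  \<open>|x'|/t\<^sup>2 + |p|/t\<close>, the size that \<open>q\<close> absorbs after multiplication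
  by \<open>t\<^sup>4|p|\<close>. Monotonicity of \<delta> and finiteness of the limit serve once
  more at the end, to pass from the decay of \<open>p\<close> to that of a Yosida approximation with
  fixed index.\<close>

lemma convex_combination_inner_nonneg:
  fixes S :: "('a::real_inner \<times> 'a) set"
  assumes mono: "\<And>p q. p \<in> S \<Longrightarrow> q \<in> S \<Longrightarrow> 0 \<le> (fst p - fst q) \<bullet> (snd p - snd q)"
    and "(a, b, c) \<in> convex hull ((\<lambda>(a, b). (a, b, a \<bullet> b)) ` S)"
  shows "a \<bullet> b \<le> c"
proof -
  let ?K = "(\<lambda>(a, b). (a, b, a \<bullet> b)) ` S"
  have half: "convex {p :: 'a \<times> 'a \<times> real. snd (snd p) - fst p \<bullet> v - u \<bullet> fst (snd p) + r \<ge> 0}" for u v r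
  proof (rule convexI, clarsimp)
    fix a b a' b' :: 'a and c c' s t :: real
    assume 1: "0 \<le> c - a \<bullet> v - u \<bullet> b + r" "0 \<le> c' - a' \<bullet> v - u \<bullet> b' + r" "0 \<le> s" "0 \<le> t" "s + t = 1"
    have "0 \<le> s * (c - a \<bullet> v - u \<bullet> b + r) + t * (c' - a' \<bullet> v - u \<bullet> b' + r)"
      using 1 by simp
    also have "\<dots> = s * c + t * c' - (s *\<^sub>R a + t *\<^sub>R a') \<bullet> v - u \<bullet> (s *\<^sub>R b + t *\<^sub>R b') + (s + t) * r"
      by (simp add: algebra_simps inner_simps)
    finally show "0 \<le> s * c + t * c' - (s *\<^sub>R a + t *\<^sub>R a') \<bullet> v - u \<bullet> (s *\<^sub>R b + t *\<^sub>R b') + r"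
      using 1 by simp
  qed
  \<comment> \<open>For a generator this is monotonicity against \<open>(u, v)\<close>; with
    \<open>(u, v)\<close> fixed the expression is affine in \<open>(a, b, c)\<close>, so it persists
    on the hull.\<close>
  have gen: "c - a \<bullet> v - u \<bullet> b + u \<bullet> v \<ge> 0" if "(a, b, c) \<in> convex hull ?K" "(u, v) \<in> S" for a b c u v
  proof -
    have "convex hull ?K \<subseteq> {p. snd (snd p) - fst p \<bullet> v - u \<bullet> fst (snd p) + u \<bullet> v \<ge> 0}"
    proof (rule hull_minimal)
      show "?K \<subseteq> {p. snd (snd p) - fst p \<bullet> v - u \<bullet> fst (snd p) + u \<bullet> v \<ge> 0}"
        using mono[OF _ that(2)] by (auto simp: inner_simps algebra_simps)
    qed (rule half)
    with that(1) show ?thesis by auto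
  qed
  \<comment> \<open>Now the hull point \<open>(a, b, c)\<close> is the fixed one and
    \<open>gen\<close> supplies the generators. Evaluated at \<open>(a, b, c)\<close> itself, the
    affine expression equals \<open>2 * (c - a \<bullet> b)\<close>.\<close>
  have "convex hull ?K \<subseteq> {p. snd (snd p) - fst p \<bullet> b - a \<bullet> fst (snd p) + c \<ge> 0}"
  proof (rule hull_minimal)
    show "?K \<subseteq> {p. snd (snd p) - fst p \<bullet> b - a \<bullet> fst (snd p) + c \<ge> 0}"
      using gen[OF assms(2)] by (auto simp: algebra_simps)
  qed (rule half)
  with assms(2) show ?thesis by auto
qed

text \<open>\<open>y\<close> minimizes the maximum over \<open>S\<close> of \<open>(y - a) \<bullet> (y + b) = |y|\<^sup>2 - (a - b) \<bullet> y - a \<bullet> b\<close>. It comes from a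
  maximizer of the dual function \<open>- |a - b|\<^sup>2/4 - c\<close> over the convex hull of the points \<open>(a, b, a \<bullet> b)\<close>. The last
  property (strong convexity) makes these minimizers a Cauchy net as \<open>S\<close> grows.\<close>
lemma finite_minimax_point:
  fixes S :: "('a::real_inner \<times> 'a) set"
  assumes "finite S" "S \<noteq> {}"
    and mono: "\<And>p q. p \<in> S \<Longrightarrow> q \<in> S \<Longrightarrow> 0 \<le> (fst p - fst q) \<bullet> (snd p - snd q)"
  obtains y m where "m \<le> 0"
    and "\<And>a b. (a, b) \<in> S \<Longrightarrow> (y - a) \<bullet> (y + b) \<le> m"
    and "\<And>z r. (\<And>a b. (a, b) \<in> S \<Longrightarrow> (z - a) \<bullet> (z + b) \<le> r) \<Longrightarrow> (norm (z - y))\<^sup>2 + m \<le> r"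
proof -
  let ?K = "convex hull ((\<lambda>(a, b). (a, b, a \<bullet> b)) ` S)"
  define g :: "'a \<times> 'a \<times> real \<Rightarrow> real"
    where "g p = - (norm (fst p - fst (snd p)))\<^sup>2 / 4 - snd (snd p)" for p
  have K: "compact ?K" "?K \<noteq> {}"
    using assms by (auto intro!: finite_imp_compact_convex_hull)
  have g: "continuous_on ?K g"
    unfolding g_def by (intro continuous_intros) simp
  obtain p where p: "p \<in> ?K" "\<And>q. q \<in> ?K \<Longrightarrow> g q \<le> g p"
    using continuous_attains_sup[OF K g] by blast
  obtain a b c where abc: "p = (a, b, c)" by (metis prod.collapse)
  \<comment> \<open>At the dual maximizer the Lagrangian
    \<open>|z|\<^sup>2 - z \<bullet> (a - b) - c\<close> is minimized over \<open>z\<close> at half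
    of \<open>a - b\<close>, with minimal value \<open>m\<close>.\<close>
  define y where "y = (1 / 2) *\<^sub>R (a - b)"
  define m where "m = - (norm y)\<^sup>2 - c"
  have ab: "a - b = 2 *\<^sub>R y" by (simp add: y_def)
  have gp: "g p = m" by (simp add: g_def abc ab m_def power_mult_distrib)
  show thesis
  proof
    \<comment> \<open>Monotonicity enters here: it bounds \<open>m\<close> by
      \<open>- |a + b|\<^sup>2/4\<close>.\<close>
    have "a \<bullet> b \<le> c"
      using convex_combination_inner_nonneg[OF mono] p(1) abc by blast
    moreover have "(norm y)\<^sup>2 + a \<bullet> b = (norm (a + b))\<^sup>2 / 4"
      unfolding y_def power2_norm_eq_inner by (simp add: inner_simps inner_commute algebra_simps)
    ultimately show "m \<le> 0"
      unfolding m_def using zero_le_power2[of "norm (a + b)"] by linarith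
  next
    fix a' b' assume S: "(a', b') \<in> S"
    define q where "q = (1 / 2) *\<^sub>R (a' - b')"
    have q: "a' - b' = 2 *\<^sub>R q" by (simp add: q_def)
    \<comment> \<open>\<open>h\<close> is the slope of \<open>g\<close> at \<open>p\<close> towards
      the vertex given by \<open>(a', b')\<close>. Maximality of \<open>p\<close> makes it
      nonpositive, and it equals \<open>(y - a') \<bullet> (y + b') - m\<close>.\<close>
    define h where "h = (y - q) \<bullet> y * 2 - a' \<bullet> b' + c"
    have K': "(a', b', a' \<bullet> b') \<in> ?K"
      using S by (intro hull_inc) force
    have le: "g ((1 - s) *\<^sub>R p + s *\<^sub>R (a', b', a' \<bullet> b')) \<le> m" if "0 \<le> s" "s \<le> 1" for s
      using p(2)[OF convexD_alt[OF convex_convex_hull p(1) K' that]] gp by simp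
    have eq: "g ((1 - s) *\<^sub>R p + s *\<^sub>R (a', b', a' \<bullet> b')) = m + s * (h - s * (norm (y - q))\<^sup>2)" for s
    proof -
      have 0: "(1 - s) *\<^sub>R a + s *\<^sub>R a' - ((1 - s) *\<^sub>R b + s *\<^sub>R b') = (1 - s) *\<^sub>R (a - b) + s *\<^sub>R (a' - b')"
        by (simp add: algebra_simps)
      have 1: "(1 - s) *\<^sub>R a + s *\<^sub>R a' - ((1 - s) *\<^sub>R b + s *\<^sub>R b') = 2 *\<^sub>R (y - s *\<^sub>R (y - q))"
        unfolding 0 ab q by (simp add: algebra_simps)
      have 2: "(norm (y - s *\<^sub>R (y - q)))\<^sup>2 = (norm y)\<^sup>2 - s * (2 * ((y - q) \<bullet> y)) + s * (s * (norm (y - q))\<^sup>2)"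
        unfolding power2_norm_eq_inner by (simp add: inner_simps inner_commute algebra_simps)
      show ?thesis
        unfolding g_def abc h_def m_def
        by (simp add: 1 power_mult_distrib 2, simp add: field_simps)
    qed
    have hs: "s * (h - s * (norm (y - q))\<^sup>2) \<le> 0" if "0 \<le> s" "s \<le> 1" for s
      using le[OF that] unfolding eq by simp
    have "h \<le> 0"
    proof (rule tendsto_upperbound)
      show "((\<lambda>s. h - s * (norm (y - q))\<^sup>2) \<longlongrightarrow> h) (at_right 0)"
        by (rule tendsto_eq_intros refl | simp)+
      have "h - s * (norm (y - q))\<^sup>2 \<le> 0" if "s \<in> {0<..<1}" for s
        using hs[of s] that by (simp add: mult_le_0_iff)
      then show "\<forall>\<^sub>F s in at_right 0. h - s * (norm (y - q))\<^sup>2 \<le> 0"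
        by (rule eventually_mono[OF eventually_at_right_real[of 0 1], rotated]) simp_all
    qed simp
    moreover have "(y - a') \<bullet> (y + b') - m = h"
    proof -
      have "(y - a') \<bullet> (y + b') = y \<bullet> y - (a' - b') \<bullet> y - a' \<bullet> b'"
        by (simp add: inner_simps inner_commute)
      then show ?thesis
        unfolding q h_def m_def power2_norm_eq_inner by (simp add: inner_simps inner_commute algebra_simps)
    qed
    ultimately show "(y - a') \<bullet> (y + b') \<le> m" by linarith
  next
    fix z r assume r: "\<And>a b. (a, b) \<in> S \<Longrightarrow> (z - a) \<bullet> (z + b) \<le> r"
    \<comment> \<open>The bound passes from the vertices to the hull point \<open>(a, b, c)\<close>,
      where the left side completes to \<open>|z - y|\<^sup>2 + m\<close>.\<close>
    have "?K \<subseteq> {p. z \<bullet> z - z \<bullet> (fst p - fst (snd p)) - snd (snd p) \<le> r}"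
    proof (rule hull_minimal)
      show "(\<lambda>(a, b). (a, b, a \<bullet> b)) ` S \<subseteq> {p. z \<bullet> z - z \<bullet> (fst p - fst (snd p)) - snd (snd p) \<le> r}"
        using r by (auto simp: inner_simps inner_commute algebra_simps)
      show "convex {p :: 'a \<times> 'a \<times> real. z \<bullet> z - z \<bullet> (fst p - fst (snd p)) - snd (snd p) \<le> r}"
      proof (rule convexI, clarsimp)
        fix a b a' b' :: 'a and c c' s t :: real
        assume 1: "z \<bullet> z - z \<bullet> (a - b) - c \<le> r" "z \<bullet> z - z \<bullet> (a' - b') - c' \<le> r" "0 \<le> s" "0 \<le> t" "s + t = 1"
        have "s * (z \<bullet> z - z \<bullet> (a - b) - c) + t * (z \<bullet> z - z \<bullet> (a' - b') - c') \<le> s * r + t * r"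
          using 1 by (intro add_mono mult_left_mono)
        also have "s * r + t * r = r"
          using 1 by (simp flip: distrib_right)
        also have "s * (z \<bullet> z - z \<bullet> (a - b) - c) + t * (z \<bullet> z - z \<bullet> (a' - b') - c') =
          (s + t) * (z \<bullet> z) - z \<bullet> (s *\<^sub>R a + t *\<^sub>R a' - (s *\<^sub>R b + t *\<^sub>R b')) - (s * c + t * c')"
          by (simp add: algebra_simps inner_simps)
        finally show "z \<bullet> z - z \<bullet> (s *\<^sub>R a + t *\<^sub>R a' - (s *\<^sub>R b + t *\<^sub>R b')) - (s * c + t * c') \<le> r"
          using 1 by simp
      qed
    qed
    then have "z \<bullet> z - z \<bullet> (a - b) - c \<le> r"
      using p(1) abc by auto
    then show "(norm (z - y))\<^sup>2 + m \<le> r"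
      unfolding ab m_def power2_norm_eq_inner by (simp add: inner_simps inner_commute algebra_simps)
  qed
qed

lemma cauchy_square_bound_convergent:
  fixes Y :: "nat \<Rightarrow> 'a::{real_normed_vector,complete_space}"
  assumes "\<And>n k. n \<le> k \<Longrightarrow> (norm (Y k - Y n))\<^sup>2 \<le> e n" and "e \<longlonglongrightarrow> 0"
  shows "convergent Y"
proof -
  have "Cauchy Y"
  proof (rule metric_CauchyI)
    fix r :: real assume "r > 0"
    then have "\<forall>\<^sub>F n in sequentially. e n < r\<^sup>2"
      using order_tendstoD(2)[OF assms(2)] by simp
    then obtain N where N: "\<And>n. n \<ge> N \<Longrightarrow> e n < r\<^sup>2"
      by (auto simp: eventually_sequentially)
    have "norm (Y n - Y m) < r" if "N \<le> m" "m \<le> n" for m n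
      using assms(1)[of m n] N[of m] that \<open>r > 0\<close> by (intro power2_less_imp_less[of _ r]) auto
    then show "\<exists>M. \<forall>m\<ge>M. \<forall>n\<ge>M. dist (Y m) (Y n) < r"
      by (metis dist_commute dist_norm nle_le)
  qed
  then show ?thesis by (simp add: Cauchy_convergent)
qed

text \<open>The conclusion says that \<open>(y, -y)\<close> is monotonically related to every pair
  of \<open>S\<close>, an extension of Debrunner-Flor type. The optimal values \<open>m F\<close> of
  finite parts grow with \<open>F\<close> and stay below \<open>0\<close>, so along finite parts
  that nearly reach their supremum the minimizers are Cauchy.\<close>

lemma monotone_set_extension_point:
  fixes S :: "('a::{real_inner,complete_space} \<times> 'a) set"
  assumes mono: "\<And>p q. p \<in> S \<Longrightarrow> q \<in> S \<Longrightarrow> 0 \<le> (fst p - fst q) \<bullet> (snd p - snd q)"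
  obtains y where "\<And>a b. (a, b) \<in> S \<Longrightarrow> (y - a) \<bullet> (y + b) \<le> 0"
proof (cases "S = {}")
  case True
  then show thesis using that by blast
next
  case False
  then obtain p0 where p0: "p0 \<in> S" by blast
  define R where "R F y m \<longleftrightarrow> m \<le> 0 \<and> (\<forall>(a, b)\<in>F. (y - a) \<bullet> (y + b) \<le> m) \<and>
    (\<forall>z r. (\<forall>(a, b)\<in>F. (z - a) \<bullet> (z + b) \<le> r) \<longrightarrow> (norm (z - y))\<^sup>2 + m \<le> r)" for F and y :: 'a and m :: real
  define Fin where "Fin = {F. finite F \<and> F \<noteq> {} \<and> F \<subseteq> S}"
  have "\<exists>y m. R F y m" if "F \<in> Fin" for F
  proof -
    have 1: "finite F" "F \<noteq> {}" "F \<subseteq> S" using that by (auto simp: Fin_def)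
    have 2: "0 \<le> (fst p - fst q) \<bullet> (snd p - snd q)" if "p \<in> F" "q \<in> F" for p q
      using mono[of p q] 1(3) that by blast
    show ?thesis
    proof (rule finite_minimax_point[OF 1(1,2) 2])
      fix y m
      assume "m \<le> 0" "\<And>a b. (a, b) \<in> F \<Longrightarrow> (y - a) \<bullet> (y + b) \<le> m"
        "\<And>z r. (\<And>a b. (a, b) \<in> F \<Longrightarrow> (z - a) \<bullet> (z + b) \<le> r) \<Longrightarrow> (norm (z - y))\<^sup>2 + m \<le> r"
      note * = this
      have "R F y m"
        unfolding R_def using *(1,2) *(3) by (auto simp: case_prod_beta') (metis fst_conv snd_conv)
      then show ?thesis by blast
    qed
  qed
  then obtain Y m where R: "\<And>F. F \<in> Fin \<Longrightarrow> R F (Y F) (m F)" by metis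
  have le: "(norm (Y G - Y F))\<^sup>2 \<le> m G - m F" if "F \<in> Fin" "G \<in> Fin" "F \<subseteq> G" for F G
  proof -
    have "\<forall>(a, b)\<in>F. (Y G - a) \<bullet> (Y G + b) \<le> m G"
      using R[OF that(2)] that(3) by (auto simp: R_def)
    then have "(norm (Y G - Y F))\<^sup>2 + m F \<le> m G"
      using R[OF that(1)] unfolding R_def by blast
    then show ?thesis by simp
  qed
  define s where "s = (SUP F\<in>Fin. m F)"
  have bdd: "bdd_above (m ` Fin)"
    using R by (auto simp: R_def intro!: bdd_aboveI[of _ 0])
  have ne: "{p0} \<in> Fin" using p0 by (auto simp: Fin_def)
  have ms: "m F \<le> s" if "F \<in> Fin" for F
    unfolding s_def using bdd that by (rule cSUP_upper2) auto
  have "\<exists>F\<in>Fin. s - 1 / Suc n < m F" for n :: nat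
    using less_cSUP_iff[OF _ bdd, of "s - 1 / Suc n"] ne unfolding s_def by auto
  then obtain H where H: "\<And>n. H n \<in> Fin" "\<And>n. s - 1 / Suc n < m (H n)" by metis
  \<comment> \<open>The sets \<open>H n\<close> need not be nested; their unions are, and enlarging
    a finite part only raises \<open>m\<close>.\<close>
  define G where "G n = (\<Union>k\<le>n. H k)" for n
  have G: "G n \<in> Fin" for n using H(1) by (auto simp: G_def Fin_def)
  have mono_G: "G n \<subseteq> G k" if "n \<le> k" for n k using that by (force simp: G_def)
  have mG: "s - 1 / Suc n < m (G n)" for n
  proof -
    have "H n \<subseteq> G n" by (auto simp: G_def)
    then have "m (H n) \<le> m (G n)" using le[OF H(1) G] zero_le_power2 by (metis diff_ge_0_iff_ge order_trans)
    then show ?thesis using H(2)[of n] by simp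
  qed
  have "convergent (\<lambda>n. Y (G n))"
  proof (rule cauchy_square_bound_convergent)
    show "(norm (Y (G k) - Y (G n)))\<^sup>2 \<le> 1 / Suc n" if "n \<le> k" for n k
      using le[OF G G mono_G[OF that]] mG[of n] ms[OF G[of k]] by linarith
  qed (rule lim_inverse_n'[THEN LIMSEQ_Suc])
  then obtain y where y: "(\<lambda>n. Y (G n)) \<longlonglongrightarrow> y" by (auto simp: convergent_def)
  show thesis
  proof
    fix a b assume ab: "(a, b) \<in> S"
    \<comment> \<open>The limit must also work for pairs outside all \<open>G n\<close>. Adding one
      pair moves the minimizer by at most \<open>1 / sqrt (n + 1)\<close>, so
      \<open>Y (G' n)\<close> has the same limit and already satisfies the inequality at
      \<open>(a, b)\<close>.\<close>
    define G' where "G' n = insert (a, b) (G n)" for n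
    have G': "G' n \<in> Fin" for n using G[of n] ab by (auto simp: G'_def Fin_def)
    have sq: "(norm (Y (G' n) - Y (G n)))\<^sup>2 \<le> 1 / Suc n" for n
      using le[OF G G', of n n] mG[of n] ms[OF G'[of n]] unfolding G'_def by fastforce
    have "(\<lambda>n. (norm (Y (G' n) - Y (G n)))\<^sup>2) \<longlonglongrightarrow> 0"
      by (rule tendsto_sandwich[OF _ _ tendsto_const lim_inverse_n'[THEN LIMSEQ_Suc]]) (use sq in auto)
    then have "(\<lambda>n. sqrt ((norm (Y (G' n) - Y (G n)))\<^sup>2)) \<longlonglongrightarrow> sqrt 0"
      by (rule tendsto_real_sqrt)
    then have "(\<lambda>n. Y (G' n) - Y (G n)) \<longlonglongrightarrow> 0"
      by (simp add: tendsto_norm_zero_iff)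
    from tendsto_add[OF this y] have "(\<lambda>n. Y (G' n)) \<longlonglongrightarrow> y" by simp
    then have "(\<lambda>n. (Y (G' n) - a) \<bullet> (Y (G' n) + b)) \<longlonglongrightarrow> (y - a) \<bullet> (y + b)"
      by (intro tendsto_intros)
    moreover have "(Y (G' n) - a) \<bullet> (Y (G' n) + b) \<le> 0" for n
      using R[OF G'[of n]] by (fastforce simp: R_def G'_def)
    ultimately show "(y - a) \<bullet> (y + b) \<le> 0"
      by (intro LIMSEQ_le_const2) auto
  qed
qed

lemma monotone_operatorD:
  "monotone_operator A \<Longrightarrow> u \<in> A x \<Longrightarrow> v \<in> A y \<Longrightarrow> 0 \<le> (x - y) \<bullet> (u - v)"
  by (auto simp: monotone_operator_def)

text \<open>The extension point is taken for the graph transformed by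
  \<open>b \<mapsto> lam b - u\<close>: compatibility of \<open>(y, -y)\<close> with it says that
  \<open>(y, v)\<close> with \<open>v = (u - y) / lam\<close> is monotonically related to the graph
  of \<open>A\<close>, and maximality forces \<open>v \<in> A y\<close>.\<close>

theorem minty:
  fixes A :: "'a::{real_inner,complete_space} \<Rightarrow> 'a set"
  assumes A: "maximally_monotone A" and "lam > 0"
  obtains y where "(1 / lam) *\<^sub>R (u - y) \<in> A y"
proof -
  have mono: "monotone_operator A" and
    max: "\<And>B. monotone_operator B \<Longrightarrow> (\<And>x. A x \<subseteq> B x) \<Longrightarrow> B = A"
    using A by (auto simp: maximally_monotone_def)
  let ?S = "{(a, lam *\<^sub>R b - u) |a b. b \<in> A a}"
  obtain y where y: "\<And>a b. (a, b) \<in> ?S \<Longrightarrow> (y - a) \<bullet> (y + b) \<le> 0"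
  proof (rule monotone_set_extension_point)
    fix p q assume "p \<in> ?S" "q \<in> ?S"
    then obtain a b a' b' where "p = (a, lam *\<^sub>R b - u)" "q = (a', lam *\<^sub>R b' - u)" "b \<in> A a" "b' \<in> A a'"
      by blast
    then show "0 \<le> (fst p - fst q) \<bullet> (snd p - snd q)"
      using monotone_operatorD[OF mono, of b a b' a'] \<open>lam > 0\<close> by (simp flip: scaleR_diff_right)
  qed blast
  define v where "v = (1 / lam) *\<^sub>R (u - y)"
  have ge: "0 \<le> (a - y) \<bullet> (b - v)" if "b \<in> A a" for a b
  proof -
    have "(y - a) \<bullet> (y + (lam *\<^sub>R b - u)) \<le> 0" using that y by blast
    also have "y + (lam *\<^sub>R b - u) = lam *\<^sub>R (b - v)"
      using \<open>lam > 0\<close> by (simp add: v_def algebra_simps)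
    finally show ?thesis using \<open>lam > 0\<close> by (simp add: inner_diff_left mult_le_0_iff)
  qed
  have "A(y := insert v (A y)) = A"
  proof (rule max)
    show "monotone_operator (A(y := insert v (A y)))"
      unfolding monotone_operator_def
    proof (intro allI impI)
      fix x x' w w' assume w: "w \<in> (A(y := insert v (A y))) x" "w' \<in> (A(y := insert v (A y))) x'"
      consider "w \<in> A x" "w' \<in> A x'" | "w \<in> A x" "x' = y" "w' = v" | "x = y" "w = v" "w' \<in> A x'" | "x = y" "w = v" "x' = y" "w' = v"
        using w by (auto split: if_splits)
      then show "0 \<le> (x - x') \<bullet> (w - w')"
      proof cases
        case 3
        have "(y - x') \<bullet> (v - w') = (x' - y) \<bullet> (w' - v)" by (simp add: inner_diff_left inner_diff_right)
        with 3 ge[OF 3(3)] show ?thesis by simp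
      qed (use monotone_operatorD[OF mono] ge in auto)
    qed
  qed auto
  then have "v \<in> A y" by (metis fun_upd_same insertI1)
  then show thesis using that by (simp add: v_def)
qed

lemma mem_range_resolvent_iff:
  fixes y u a :: "'a::real_vector"
  assumes "lam > 0"
  shows "u \<in> (\<lambda>a. y + lam *\<^sub>R a) ` B \<longleftrightarrow> (1 / lam) *\<^sub>R (u - y) \<in> B"
proof
  assume "(1 / lam) *\<^sub>R (u - y) \<in> B"
  moreover have "u = y + lam *\<^sub>R (1 / lam) *\<^sub>R (u - y)" using assms by simp
  ultimately show "u \<in> (\<lambda>a. y + lam *\<^sub>R a) ` B" by (rule rev_image_eqI)
qed (use assms in auto)

text \<open>Stated for arbitrary solutions \<open>a\<close>, \<open>b\<close> rather than for \<open>yosida\<close>, since it also yields the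
  uniqueness on which the \<open>THE\<close> in \<open>resolvent\<close> depends.\<close>
lemma yosida_norm_diff_aux:
  fixes A :: "'a::real_inner \<Rightarrow> 'a set"
  assumes "monotone_operator A" "lam > 0" "mu > 0"
    and "a \<in> A (u - lam *\<^sub>R a)" "b \<in> A (v - mu *\<^sub>R b)"
  shows "lam * norm (a - b) \<le> norm (u - v) + \<bar>mu - lam\<bar> * norm b"
proof (cases "a = b")
  case False
  have "0 \<le> (u - lam *\<^sub>R a - (v - mu *\<^sub>R b)) \<bullet> (a - b)"
    using monotone_operatorD[OF assms(1,4,5)] .
  also have "u - lam *\<^sub>R a - (v - mu *\<^sub>R b) = (u - v) + (mu - lam) *\<^sub>R b - lam *\<^sub>R (a - b)"
    by (simp add: algebra_simps)
  finally have "lam * norm (a - b) * norm (a - b) \<le> ((u - v) + (mu - lam) *\<^sub>R b) \<bullet> (a - b)"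
    by (simp add: inner_diff_left inner_add_left dot_square_norm power2_eq_square)
  also have "\<dots> \<le> norm ((u - v) + (mu - lam) *\<^sub>R b) * norm (a - b)"
    by (rule norm_cauchy_schwarz)
  finally have "lam * norm (a - b) \<le> norm ((u - v) + (mu - lam) *\<^sub>R b)"
    using False by simp
  also have "\<dots> \<le> norm (u - v) + \<bar>mu - lam\<bar> * norm b"
    by (metis norm_scaleR norm_triangle_ineq)
  finally show ?thesis .
qed auto

lemma resolvent_unique:
  fixes A :: "'a::real_inner \<Rightarrow> 'a set"
  assumes "monotone_operator A" "lam > 0" and y: "(1 / lam) *\<^sub>R (u - y) \<in> A y"
  shows "resolvent lam A u = y"
  unfolding resolvent_def
proof (rule the_equality)
  show "u \<in> (\<lambda>a. y + lam *\<^sub>R a) ` A y"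
    using y assms(2) by (simp add: mem_range_resolvent_iff)
  fix z assume "u \<in> (\<lambda>a. z + lam *\<^sub>R a) ` A z"
  then have z: "(1 / lam) *\<^sub>R (u - z) \<in> A z"
    using assms(2) by (simp add: mem_range_resolvent_iff)
  have "lam * norm ((1 / lam) *\<^sub>R (u - z) - (1 / lam) *\<^sub>R (u - y)) \<le> norm (u - u) + \<bar>lam - lam\<bar> * norm ((1 / lam) *\<^sub>R (u - y))"
    using assms y z by (intro yosida_norm_diff_aux) auto
  then show "z = y"
    using assms(2) by (simp flip: scaleR_diff_right)
qed

lemma yosida_mem:
  fixes A :: "'a::{real_inner,complete_space} \<Rightarrow> 'a set"
  assumes "maximally_monotone A" "lam > 0"
  shows "yosida A lam u \<in> A (u - lam *\<^sub>R yosida A lam u)"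
proof -
  obtain y where y: "(1 / lam) *\<^sub>R (u - y) \<in> A y"
    using minty[OF assms] .
  have "resolvent lam A u = y"
    using resolvent_unique[of A, OF _ assms(2) y] assms(1) by (simp add: maximally_monotone_def)
  then show ?thesis using y assms(2) by (simp add: yosida_def)
qed

text \<open>Index and point vary together because \<open>\<gamma> t\<close> moves along the
  trajectory. The case of equal points with indices \<open>1\<close> and \<open>\<gamma> t\<close>
  serves the weak convergence.\<close>

lemma yosida_norm_diff:
  fixes A :: "'a::{real_inner,complete_space} \<Rightarrow> 'a set"
  assumes "maximally_monotone A" "lam > 0" "mu > 0"
  shows "lam * norm (yosida A lam u - yosida A mu v) \<le> norm (u - v) + \<bar>mu - lam\<bar> * norm (yosida A mu v)"
  using assms by (intro yosida_norm_diff_aux[of A] yosida_mem) (auto simp: maximally_monotone_def)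

lemma yosida_cocoercive:
  fixes A :: "'a::{real_inner,complete_space} \<Rightarrow> 'a set"
  assumes "maximally_monotone A" "lam > 0" "z \<in> zer A"
  shows "lam * (norm (yosida A lam u))\<^sup>2 \<le> (u - z) \<bullet> yosida A lam u"
proof -
  have "0 \<le> (u - lam *\<^sub>R yosida A lam u - z) \<bullet> (yosida A lam u - 0)"
    using assms by (intro monotone_operatorD[of A] yosida_mem) (auto simp: maximally_monotone_def zer_def)
  then show ?thesis by (simp add: inner_diff_left dot_square_norm)
qed

lemma zer_iff_yosida_eq_0:
  fixes A :: "'a::{real_inner,complete_space} \<Rightarrow> 'a set"
  assumes "maximally_monotone A" "lam > 0"
  shows "z \<in> zer A \<longleftrightarrow> yosida A lam z = 0"
proof
  assume "yosida A lam z = 0"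
  then show "z \<in> zer A" using yosida_mem[OF assms, of z] by (simp add: zer_def)
next
  assume "z \<in> zer A"
  then show "yosida A lam z = 0"
    using yosida_cocoercive[OF assms, of z z] assms(2) by (simp add: mult_le_0_iff)
qed

section \<open>Asymptotic centers and Opial's argument\<close>

text \<open>\<open>m\<close> is the infimum of the eventual bounds on the squared distance, the
  squared asymptotic radius, and \<open>y\<close> is its center. The parallelogram identity makes
  near-minimizers Cauchy and gives the quadratic growth in the second property. A general filter is
  allowed because the lemma is also needed for a filter finer than \<open>at_top\<close>.\<close>

lemma asymptotic_center:
  fixes x :: "'b \<Rightarrow> 'a::{real_inner,complete_space}"
  assumes F: "F \<noteq> bot" and bnd: "\<forall>\<^sub>F t in F. norm (x t) \<le> B"
  obtains y m where "\<And>e. e > 0 \<Longrightarrow> \<forall>\<^sub>F t in F. (norm (x t - y))\<^sup>2 \<le> m + e"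
    and "\<And>z r. \<forall>\<^sub>F t in F. (norm (x t - z))\<^sup>2 \<le> r \<Longrightarrow> m + (norm (z - y))\<^sup>2 / 2 \<le> r"
proof -
  define V where "V = {r. \<exists>y. \<forall>\<^sub>F t in F. (norm (x t - y))\<^sup>2 \<le> r}"
  define m where "m = Inf V"
  have V0: "r \<ge> 0" if r: "r \<in> V" for r
  proof -
    obtain y where "\<forall>\<^sub>F t in F. (norm (x t - y))\<^sup>2 \<le> r" using r unfolding V_def by blast
    then obtain t where "(norm (x t - y))\<^sup>2 \<le> r" using eventually_happens'[OF F] by blast
    then show ?thesis by (rule order_trans[OF zero_le_power2])
  qed
  have "B\<^sup>2 \<in> V"
    unfolding V_def using bnd
    by (auto intro!: exI[of _ 0] elim!: eventually_mono simp: power_mono)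
  then have ne: "V \<noteq> {}" by blast
  have bdd: "bdd_below V" using V0 by (rule bdd_belowI)
  have m_le: "m \<le> r" if "r \<in> V" for r
    unfolding m_def using that bdd by (rule cInf_lower)
  have m0: "m \<ge> 0" unfolding m_def using ne V0 by (rule cInf_greatest)
  \<comment> \<open>The midpoint of two candidate centers is a competitor, and its squared radius
    gains a quarter of their squared distance.\<close>
  have mid: "m \<le> (r + r') / 2 - (norm (z - z'))\<^sup>2 / 4"
    if "\<forall>\<^sub>F t in F. (norm (x t - z))\<^sup>2 \<le> r" "\<forall>\<^sub>F t in F. (norm (x t - z'))\<^sup>2 \<le> r'" for z z' r r'
  proof (rule m_le)
    have "(norm (u - (1 / 2) *\<^sub>R (z + z')))\<^sup>2 = ((norm (u - z))\<^sup>2 + (norm (u - z'))\<^sup>2) / 2 - (norm (z - z'))\<^sup>2 / 4" for u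
      unfolding power2_norm_eq_inner by (simp add: inner_simps inner_commute field_simps)
    then have "\<forall>\<^sub>F t in F. (norm (x t - (1 / 2) *\<^sub>R (z + z')))\<^sup>2 \<le> (r + r') / 2 - (norm (z - z'))\<^sup>2 / 4"
      using that by (auto elim: eventually_elim2)
    then show "(r + r') / 2 - (norm (z - z'))\<^sup>2 / 4 \<in> V"
      unfolding V_def by blast
  qed
  have "\<exists>y. \<forall>\<^sub>F t in F. (norm (x t - y))\<^sup>2 \<le> m + 1 / Suc n" for n :: nat
  proof -
    have "Inf V < m + 1 / Suc n" by (simp add: m_def)
    then obtain r where "r \<in> V" "r < m + 1 / Suc n" using cInf_lessD[OF ne] by blast
    then obtain z where "\<forall>\<^sub>F t in F. (norm (x t - z))\<^sup>2 \<le> r" unfolding V_def by blast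
    then have "\<forall>\<^sub>F t in F. (norm (x t - z))\<^sup>2 \<le> m + 1 / Suc n"
      by (rule eventually_mono) (use \<open>r < m + 1 / Suc n\<close> in linarith)
    then show ?thesis ..
  qed
  then have "\<forall>n. \<exists>y. \<forall>\<^sub>F t in F. (norm (x t - y))\<^sup>2 \<le> m + 1 / Suc n" ..
  from choice[OF this] obtain Y where Y: "\<And>n. \<forall>\<^sub>F t in F. (norm (x t - Y n))\<^sup>2 \<le> m + 1 / Suc n" by blast
  have lim: "(\<lambda>n. 1 / real (Suc n)) \<longlonglongrightarrow> 0"
    by (rule lim_inverse_n'[THEN LIMSEQ_Suc])
  have "convergent Y"
  proof (rule cauchy_square_bound_convergent)
    show "(norm (Y k - Y n))\<^sup>2 \<le> 4 * (1 / Suc n)" if "n \<le> k" for n k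
    proof -
      have "1 / real (Suc k) \<le> 1 / real (Suc n)" using that by (simp add: frac_le)
      moreover have "N \<le> 4 * b" if "m \<le> (m + a + (m + b)) / 2 - N / 4" "a \<le> b" for N a b :: real
        using that by (simp add: field_simps)
      ultimately show ?thesis using mid[OF Y[of k] Y[of n]] by blast
    qed
    show "(\<lambda>n. 4 * (1 / real (Suc n))) \<longlonglongrightarrow> 0"
      using tendsto_mult_right_zero[OF lim] .
  qed
  then obtain y where y: "Y \<longlonglongrightarrow> y" by (auto simp: convergent_def)
  show thesis
  proof
    fix e :: real assume "e > 0"
    have "(\<lambda>n. (sqrt (m + 1 / Suc n) + norm (Y n - y))\<^sup>2) \<longlonglongrightarrow> (sqrt (m + 0) + norm (y - y))\<^sup>2"
      by (intro tendsto_intros y lim)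
    then have "\<forall>\<^sub>F n in sequentially. (sqrt (m + 1 / Suc n) + norm (Y n - y))\<^sup>2 < m + e"
      using m0 \<open>e > 0\<close> by (intro order_tendstoD(2)) auto
    from eventually_happens'[OF sequentially_bot this]
    obtain n where n: "(sqrt (m + 1 / Suc n) + norm (Y n - y))\<^sup>2 < m + e" by blast
    show "\<forall>\<^sub>F t in F. (norm (x t - y))\<^sup>2 \<le> m + e"
      using Y[of n]
    proof (rule eventually_mono)
      fix t assume "(norm (x t - Y n))\<^sup>2 \<le> m + 1 / Suc n"
      then have "norm (x t - Y n) \<le> sqrt (m + 1 / Suc n)" by (rule real_le_rsqrt)
      moreover have "norm (x t - y) \<le> norm (x t - Y n) + norm (Y n - y)"
        using norm_triangle_ineq[of "x t - Y n" "Y n - y"] by simp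
      ultimately have "(norm (x t - y))\<^sup>2 \<le> (sqrt (m + 1 / Suc n) + norm (Y n - y))\<^sup>2"
        by (intro power_mono) auto
      then show "(norm (x t - y))\<^sup>2 \<le> m + e" using n by simp
    qed
  next
    fix z r assume r: "\<forall>\<^sub>F t in F. (norm (x t - z))\<^sup>2 \<le> r"
    have "(\<lambda>n. (r + (m + 1 / Suc n)) / 2 - (norm (z - Y n))\<^sup>2 / 4) \<longlonglongrightarrow> (r + (m + 0)) / 2 - (norm (z - y))\<^sup>2 / 4"
      by (intro tendsto_intros y lim) auto
    then have "m \<le> (r + (m + 0)) / 2 - (norm (z - y))\<^sup>2 / 4"
      using mid[OF r Y] by (intro LIMSEQ_le_const) auto
    then show "m + (norm (z - y))\<^sup>2 / 2 \<le> r" by (simp add: field_simps)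
  qed
qed

text \<open>A nonexpansive map does not increase asymptotic radii, so it fixes the unique asymptotic
  center of an asymptotically invariant family. This replaces demiclosedness and the weak
  compactness of bounded sets.\<close>
lemma asymptotic_center_fixpoint:
  fixes x :: "'b \<Rightarrow> 'a::{real_inner,complete_space}"
  assumes F: "F \<noteq> bot" "\<forall>\<^sub>F t in F. norm (x t) \<le> B"
    and T: "\<And>y z. norm (T y - T z) \<le> norm (y - z)"
    and inv: "((\<lambda>t. x t - T (x t)) \<longlongrightarrow> 0) F"
    and lim: "\<And>z. T z = z \<Longrightarrow> ((\<lambda>t. norm (x t - z)) \<longlongrightarrow> l z) F"
  obtains y where "T y = y"
    and "\<And>z r. \<forall>\<^sub>F t in F. (norm (x t - z))\<^sup>2 \<le> r \<Longrightarrow> (l y)\<^sup>2 + (norm (z - y))\<^sup>2 / 2 \<le> r"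
proof -
  obtain y m where y: "\<And>e. e > 0 \<Longrightarrow> \<forall>\<^sub>F t in F. (norm (x t - y))\<^sup>2 \<le> m + e"
    and m: "\<And>z r. \<forall>\<^sub>F t in F. (norm (x t - z))\<^sup>2 \<le> r \<Longrightarrow> m + (norm (z - y))\<^sup>2 / 2 \<le> r"
    using asymptotic_center[OF F] by blast
  have m0: "0 \<le> m"
  proof (rule field_le_epsilon)
    fix e :: real assume "e > 0"
    from eventually_happens'[OF F(1) y[OF this]] obtain t where "(norm (x t - y))\<^sup>2 \<le> m + e" by blast
    then show "0 \<le> m + e" by (rule order_trans[OF zero_le_power2])
  qed
  have close: "m + (norm (T y - y))\<^sup>2 / 2 \<le> m + e" if "e > 0" for e
  proof (rule m)
    have "((\<lambda>t. (norm (x t - T (x t)) + sqrt (m + e / 2))\<^sup>2) \<longlongrightarrow> (norm (0::'a) + sqrt (m + e / 2))\<^sup>2) F"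
      by (intro tendsto_intros inv)
    then have "\<forall>\<^sub>F t in F. (norm (x t - T (x t)) + sqrt (m + e / 2))\<^sup>2 < m + e"
      using m0 that by (intro order_tendstoD(2)) auto
    moreover have "\<forall>\<^sub>F t in F. (norm (x t - y))\<^sup>2 \<le> m + e / 2" using that by (intro y) simp
    ultimately show "\<forall>\<^sub>F t in F. (norm (x t - T y))\<^sup>2 \<le> m + e"
    proof (rule eventually_elim2)
      fix t assume 1: "(norm (x t - T (x t)) + sqrt (m + e / 2))\<^sup>2 < m + e" "(norm (x t - y))\<^sup>2 \<le> m + e / 2"
      have "norm (x t - T y) \<le> norm (x t - T (x t)) + norm (T (x t) - T y)"
        using norm_triangle_ineq[of "x t - T (x t)" "T (x t) - T y"] by simp
      also have "norm (T (x t) - T y) \<le> norm (x t - y)" by (rule T)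
      also have "norm (x t - y) \<le> sqrt (m + e / 2)" using 1(2) by (rule real_le_rsqrt)
      finally have "(norm (x t - T y))\<^sup>2 \<le> (norm (x t - T (x t)) + sqrt (m + e / 2))\<^sup>2"
        by (intro power_mono) auto
      then show "(norm (x t - T y))\<^sup>2 \<le> m + e" using 1(1) by simp
    qed
  qed
  have "(norm (T y - y))\<^sup>2 / 2 \<le> 0"
    by (rule field_le_epsilon) (use close in simp)
  then have fix_y: "T y = y" by simp
  \<comment> \<open>Distances to fixed points converge, so the radius can be expressed by
    \<open>l\<close>. That makes centers belonging to different filters comparable.\<close>
  have "(l y)\<^sup>2 \<le> m"
  proof (rule field_le_epsilon)
    fix e :: real assume "e > 0"
    show "(l y)\<^sup>2 \<le> m + e"
      by (rule tendsto_upperbound[OF tendsto_power[OF lim[OF fix_y]] y[OF \<open>e > 0\<close>] F(1)])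
  qed
  then have "(l y)\<^sup>2 + (norm (z - y))\<^sup>2 / 2 \<le> r" if "\<forall>\<^sub>F t in F. (norm (x t - z))\<^sup>2 \<le> r" for z r
    using m[OF that] by linarith
  with fix_y show thesis by (rule that)
qed

text \<open>The weak limit is the asymptotic center \<open>c\<close> of the whole trajectory. If
  some direction \<open>u\<close> were bad, the bad times would give a finer filter whose center is
  also a fixed point. The growth inequalities identify it with \<open>c\<close>, and then shifting
  \<open>c\<close> along \<open>u\<close> would lower the radius on the bad times.\<close>

lemma nonexpansive_opial:
  fixes x :: "real \<Rightarrow> 'a::{real_inner,complete_space}"
  assumes bnd: "\<forall>\<^sub>F t in at_top. norm (x t) \<le> B"
    and T: "\<And>y z. norm (T y - T z) \<le> norm (y - z)"
    and inv: "((\<lambda>t. x t - T (x t)) \<longlongrightarrow> 0) at_top"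
    and lim: "\<And>z. T z = z \<Longrightarrow> \<exists>l. ((\<lambda>t. norm (x t - z)) \<longlongrightarrow> l) at_top"
  shows "\<exists>z. T z = z \<and> converges_weakly x z"
proof -
  obtain l where l: "\<And>z. T z = z \<Longrightarrow> ((\<lambda>t. norm (x t - z)) \<longlongrightarrow> l z) at_top"
    using lim by metis
  obtain c where c: "T c = c"
    and c_min: "\<And>z r. \<forall>\<^sub>F t in at_top. (norm (x t - z))\<^sup>2 \<le> r \<Longrightarrow> (l c)\<^sup>2 + (norm (z - c))\<^sup>2 / 2 \<le> r"
    using asymptotic_center_fixpoint[OF _ bnd T inv l] by auto
  have near: "\<forall>\<^sub>F t in G. (norm (x t - z))\<^sup>2 \<le> (l z)\<^sup>2 + e"
    if "e > 0" "T z = z" "G \<le> at_top" for e z G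
  proof -
    have "((\<lambda>t. (norm (x t - z))\<^sup>2) \<longlongrightarrow> (l z)\<^sup>2) G"
      using tendsto_mono[OF that(3) l[OF that(2)]] by (rule tendsto_power)
    then have "\<forall>\<^sub>F t in G. (norm (x t - z))\<^sup>2 < (l z)\<^sup>2 + e"
      using that(1) by (intro order_tendstoD(2)) auto
    then show ?thesis by (rule eventually_mono) simp
  qed
  have upper: "\<forall>\<^sub>F t in at_top. (x t - c) \<bullet> u < e" if e: "e > 0" for u e
  proof (rule ccontr)
    assume neg: "\<not> ?thesis"
    \<comment> \<open>Failure of an eventual statement means exactly that restricting
      \<open>at_top\<close> to the exceptions leaves a proper filter.\<close>
    define G where "G = inf at_top (principal {t. \<not> (x t - c) \<bullet> u < e})"
    have G: "G \<noteq> bot" "G \<le> at_top"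
      using neg by (auto simp: G_def trivial_limit_def eventually_inf_principal)
    obtain d where d: "T d = d"
      and d_min: "\<And>z r. \<forall>\<^sub>F t in G. (norm (x t - z))\<^sup>2 \<le> r \<Longrightarrow> (l d)\<^sup>2 + (norm (z - d))\<^sup>2 / 2 \<le> r"
      using asymptotic_center_fixpoint[OF G(1) filter_leD[OF G(2) bnd] T tendsto_mono[OF G(2) inv] tendsto_mono[OF G(2) l]] by blast
    \<comment> \<open>Each center is tested as a competitor of the other, \<open>c\<close> on
      \<open>G\<close> and \<open>d\<close> on \<open>at_top\<close>; adding the two inequalities
      forces \<open>d = c\<close>.\<close>
    have "(l d)\<^sup>2 + (norm (c - d))\<^sup>2 / 2 \<le> (l c)\<^sup>2"
      by (rule field_le_epsilon) (intro d_min near c G(2))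
    moreover have "(l c)\<^sup>2 + (norm (d - c))\<^sup>2 / 2 \<le> (l d)\<^sup>2"
      by (rule field_le_epsilon) (intro c_min near d order_refl)
    ultimately have "(norm (c - d))\<^sup>2 \<le> 0"
      using zero_le_power2[of "norm (d - c)"] by linarith
    then have "d = c" by simp
    \<comment> \<open>The step is so short that \<open>s * |u|\<^sup>2 \<le> e\<close>, and the gain
      \<open>2 * s * e\<close> outweighs the quadratic cost; the \<open>+ 1\<close> covers
      \<open>u = 0\<close>.\<close>
    define s where "s = e / ((norm u)\<^sup>2 + 1)"
    have den: "(norm u)\<^sup>2 + 1 > 0" using zero_le_power2[of "norm u"] by linarith
    have s: "s > 0" "s * ((norm u)\<^sup>2 + 1) = e" using e den by (auto simp: s_def)
    have "(l c)\<^sup>2 + (norm (c + s *\<^sub>R u - c))\<^sup>2 / 2 \<le> (l c)\<^sup>2 - 2 * s * e + s\<^sup>2 * (norm u)\<^sup>2"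
    proof (rule field_le_epsilon)
      fix r :: real assume "r > 0"
      have "\<forall>\<^sub>F t in G. (norm (x t - c))\<^sup>2 \<le> (l c)\<^sup>2 + r"
        using near[OF \<open>r > 0\<close> c G(2)] .
      moreover have "\<forall>\<^sub>F t in G. (x t - c) \<bullet> u \<ge> e"
        unfolding G_def by (simp add: eventually_inf_principal not_less)
      ultimately have "\<forall>\<^sub>F t in G. (norm (x t - (c + s *\<^sub>R u)))\<^sup>2 \<le> (l c)\<^sup>2 - 2 * s * e + s\<^sup>2 * (norm u)\<^sup>2 + r"
      proof (rule eventually_elim2)
        fix t assume 1: "(norm (x t - c))\<^sup>2 \<le> (l c)\<^sup>2 + r" "(x t - c) \<bullet> u \<ge> e"
        have "(norm (x t - (c + s *\<^sub>R u)))\<^sup>2 = (norm (x t - c))\<^sup>2 - 2 * s * ((x t - c) \<bullet> u) + s\<^sup>2 * (norm u)\<^sup>2"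
        proof -
          have "x t - (c + s *\<^sub>R u) = (x t - c) - s *\<^sub>R u" by simp
          then show ?thesis
            by (simp only: power2_norm_eq_inner) (simp add: inner_diff_left inner_diff_right inner_commute power2_eq_square algebra_simps)
        qed
        moreover have "2 * s * e \<le> 2 * s * ((x t - c) \<bullet> u)" using 1(2) s(1) by simp
        ultimately show "(norm (x t - (c + s *\<^sub>R u)))\<^sup>2 \<le> (l c)\<^sup>2 - 2 * s * e + s\<^sup>2 * (norm u)\<^sup>2 + r"
          using 1(1) by linarith
      qed
      from d_min[OF this] show "(l c)\<^sup>2 + (norm (c + s *\<^sub>R u - c))\<^sup>2 / 2 \<le> (l c)\<^sup>2 - 2 * s * e + s\<^sup>2 * (norm u)\<^sup>2 + r"
        unfolding \<open>d = c\<close> .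
    qed
    then have "2 * s * e \<le> s\<^sup>2 * (norm u)\<^sup>2 / 2"
      by (simp add: power_mult_distrib)
    then have "s * (2 * e) \<le> s * (s * (norm u)\<^sup>2 / 2)"
      by (simp add: power2_eq_square algebra_simps)
    then have "2 * e \<le> s * (norm u)\<^sup>2 / 2" using s(1) by simp
    moreover have "s * (norm u)\<^sup>2 \<le> e" using s by (simp add: distrib_left)
    ultimately show False using e by linarith
  qed
  have "((\<lambda>t. x t \<bullet> u) \<longlongrightarrow> c \<bullet> u) at_top" for u
  proof (rule tendstoI)
    fix e :: real assume "e > 0"
    from eventually_conj[OF upper[OF this, of u] upper[OF this, of "- u"]]
    show "\<forall>\<^sub>F t in at_top. dist (x t \<bullet> u) (c \<bullet> u) < e"
      by (rule eventually_mono) (auto simp: dist_real_def inner_diff_left abs_if)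
  qed
  then show ?thesis using c unfolding converges_weakly_def by blast
qed

section \<open>Absolutely continuous functions\<close>

text \<open>The definition numbers its intervals by naturals below \<open>n\<close>, whereas a
  tagged division is a finite set of pairs; a bijection carries the condition over.\<close>

lemma absolutely_continuous_fun_sum_less:
  fixes l r :: "'i \<Rightarrow> real"
  assumes "\<forall>(n::nat) l r. (\<forall>i<n. a \<le> l i \<and> l i \<le> r i \<and> r i \<le> b) \<longrightarrow>
        disjoint_family_on (\<lambda>i. {l i<..<r i}) {..<n} \<longrightarrow>
        (\<Sum>i<n. r i - l i) < d \<longrightarrow> (\<Sum>i<n. norm (f (r i) - f (l i))) < (e::real)"
    and "finite I" "\<And>i. i \<in> I \<Longrightarrow> a \<le> l i \<and> l i \<le> r i \<and> r i \<le> b"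
    and "disjoint_family_on (\<lambda>i. {l i<..<r i}) I" "(\<Sum>i\<in>I. r i - l i) < d"
  shows "(\<Sum>i\<in>I. norm (f (r i) - f (l i))) < e"
proof -
  obtain h where h: "bij_betw h {..<card I} I"
    using ex_bij_betw_nat_finite[OF assms(2)] by (auto simp: atLeast0LessThan)
  have h': "h i \<in> I" if "i < card I" for i
    using h that by (auto simp: bij_betw_def)
  have "(\<Sum>i<card I. norm (f (r (h i)) - f (l (h i)))) < e"
  proof (rule assms(1)[rule_format])
    show "a \<le> l (h i) \<and> l (h i) \<le> r (h i) \<and> r (h i) \<le> b" if "i < card I" for i
      using assms(3) h' that by blast
    show "disjoint_family_on (\<lambda>i. {l (h i)<..<r (h i)}) {..<card I}"
      unfolding disjoint_family_on_def
    proof (intro ballI impI)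
      fix m n assume mn: "m \<in> {..<card I}" "n \<in> {..<card I}" "m \<noteq> n"
      then have "h m \<noteq> h n" using h by (auto simp: bij_betw_def inj_on_def)
      then show "{l (h m)<..<r (h m)} \<inter> {l (h n)<..<r (h n)} = {}"
        using assms(4) h' mn unfolding disjoint_family_on_def by blast
    qed
    show "(\<Sum>i<card I. r (h i) - l (h i)) < d"
      using assms(5) sum.reindex_bij_betw[OF h, of "\<lambda>i. r i - l i"] by simp
  qed
  then show ?thesis
    using sum.reindex_bij_betw[OF h, of "\<lambda>i. norm (f (r i) - f (l i))"] by simp
qed

lemma sum_length_le_measure:
  fixes l r :: "'i \<Rightarrow> real"
  assumes "finite I" "disjoint_family_on (\<lambda>i. {l i<..<r i}) I" "\<And>i. i \<in> I \<Longrightarrow> l i \<le> r i"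
    and "\<And>i. i \<in> I \<Longrightarrow> {l i<..<r i} \<subseteq> U" "U \<in> lmeasurable"
  shows "(\<Sum>i\<in>I. r i - l i) \<le> measure lebesgue U"
proof -
  have "(\<Sum>i\<in>I. r i - l i) = (\<Sum>i\<in>I. measure lebesgue {l i<..<r i})"
    using assms(3) by (intro sum.cong) auto
  also have "\<dots> = measure lebesgue (\<Union>i\<in>I. {l i<..<r i})"
    by (rule measure_finite_Union[symmetric]) (use assms(1,2,3) in auto)
  also have "\<dots> \<le> measure lebesgue U"
    by (rule measure_mono_fmeasurable) (use assms(1,4,5) in auto)
  finally show ?thesis .
qed

text \<open>A covering argument takes the place of integrating the derivative. In a fine tagged
  division, tags off \<open>N\<close> have increments at most \<open>e\<close> times the length.
  Intervals tagged in \<open>N\<close> lie in an open set of measure below \<open>d\<close>, so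
  absolute continuity bounds their total increment.\<close>

lemma absolutely_continuous_deriv_nonpos_decreasing:
  fixes f :: "real \<Rightarrow> real"
  assumes ac: "absolutely_continuous_fun a b f" and "a \<le> b" and N: "negligible N"
    and deriv: "\<And>t. t \<in> {a..b} - N \<Longrightarrow> \<exists>D\<le>0. (f has_real_derivative D) (at t within {a..b})"
  shows "f b \<le> f a"
proof (rule field_le_epsilon)
  fix e0 :: real assume "e0 > 0"
  \<comment> \<open>The budget is \<open>e\<close> for the intervals tagged in \<open>N\<close> and
    \<open>e * (b - a)\<close> for all others.\<close>
  define e where "e = e0 / (1 + (b - a))"
  have e: "e > 0" using \<open>e0 > 0\<close> \<open>a \<le> b\<close> by (simp add: e_def)
  have e_eq: "e + e * (b - a) = e0"
  proof -
    have "e * (1 + (b - a)) = e0" using \<open>a \<le> b\<close> by (simp add: e_def)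
    then show ?thesis by (simp add: distrib_left)
  qed
  obtain d where "d > 0" and d: "\<forall>(n::nat) l r. (\<forall>i<n. a \<le> l i \<and> l i \<le> r i \<and> r i \<le> b) \<longrightarrow>
        disjoint_family_on (\<lambda>i. {l i<..<r i}) {..<n} \<longrightarrow>
        (\<Sum>i<n. r i - l i) < d \<longrightarrow> (\<Sum>i<n. norm (f (r i) - f (l i))) < e"
    using ac e unfolding absolutely_continuous_fun_def by blast
  obtain U where U: "open U" "N \<subseteq> U" "U \<in> lmeasurable" "measure lebesgue U < d"
  proof -
    have N0: "N \<in> sets lebesgue" "emeasure lebesgue N = 0"
      using N by (auto simp: negligible_iff_null_sets)
    obtain U where U: "open U" "N \<subseteq> U" "U - N \<in> lmeasurable" "emeasure lebesgue (U - N) < ennreal d"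
      using sets_lebesgue_outer_open[OF N0(1) \<open>d > 0\<close>] by metis
    have "U = (U - N) \<union> N" using U(2) by auto
    then have "emeasure lebesgue U = emeasure lebesgue (U - N)"
      using N U(3) by (metis emeasure_Un_null_set fmeasurableD negligible_iff_null_sets)
    then have less: "emeasure lebesgue U < ennreal d" using U(4) by simp
    have "U \<in> sets lebesgue" using U(1) by (metis borel_open sets_completionI_sets sets_lborel)
    moreover have fin: "emeasure lebesgue U < \<infinity>" using less by (rule less_trans) simp
    ultimately have "U \<in> lmeasurable" by (rule fmeasurableI)
    moreover have "measure lebesgue U < d"
    proof -
      have "emeasure lebesgue U = ennreal (measure lebesgue U)"
        using fin by (intro emeasure_eq_ennreal_measure) auto
      with less show ?thesis by (simp add: ennreal_less_iff)
    qed
    ultimately show thesis by (rule that[OF U(1,2)])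
  qed
  \<comment> \<open>The two sides of \<open>t\<close> are estimated separately because a tag may sit
    anywhere in its interval; the two estimates then add up.\<close>
  have "\<exists>\<rho>>0. t \<notin> N \<longrightarrow> (\<forall>s\<in>{a..b}. \<bar>s - t\<bar> < \<rho> \<longrightarrow> (s \<ge> t \<longrightarrow> f s - f t \<le> e * (s - t)) \<and> (s \<le> t \<longrightarrow> f t - f s \<le> e * (t - s)))"
    if t: "t \<in> {a..b}" for t
  proof (cases "t \<in> N")
    case False
    then obtain D where D: "D \<le> 0" "(f has_real_derivative D) (at t within {a..b})"
      using deriv t by blast
    then have "(f has_derivative (*) D) (at t within {a..b})" by (simp add: has_field_derivative_def)
    then obtain \<rho> where \<rho>: "\<rho> > 0" "\<And>s. s \<in> {a..b} \<Longrightarrow> norm (s - t) < \<rho> \<Longrightarrow> norm (f s - f t - D * (s - t)) \<le> e * norm (s - t)"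
      using e unfolding has_derivative_within_alt by blast
    have "(s \<ge> t \<longrightarrow> f s - f t \<le> e * (s - t)) \<and> (s \<le> t \<longrightarrow> f t - f s \<le> e * (t - s))"
      if "s \<in> {a..b}" "\<bar>s - t\<bar> < \<rho>" for s
    proof -
      have "\<bar>f s - f t - D * (s - t)\<bar> \<le> e * \<bar>s - t\<bar>" using \<rho>(2)[of s] that by simp
      moreover have "s \<ge> t \<Longrightarrow> D * (s - t) \<le> 0" "s \<le> t \<Longrightarrow> D * (s - t) \<ge> 0"
        using D(1) by (auto simp: mult_le_0_iff zero_le_mult_iff)
      ultimately show ?thesis by (auto simp: abs_if algebra_simps split: if_splits)
    qed
    with \<rho>(1) show ?thesis by blast
  qed (auto intro: exI[of _ 1])
  then obtain \<rho> where \<rho>: "\<And>t. t \<in> {a..b} \<Longrightarrow> \<rho> t > 0"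
    "\<And>t s. t \<in> {a..b} - N \<Longrightarrow> s \<in> {a..b} \<Longrightarrow> \<bar>s - t\<bar> < \<rho> t \<Longrightarrow> s \<ge> t \<Longrightarrow> f s - f t \<le> e * (s - t)"
    "\<And>t s. t \<in> {a..b} - N \<Longrightarrow> s \<in> {a..b} \<Longrightarrow> \<bar>s - t\<bar> < \<rho> t \<Longrightarrow> s \<le> t \<Longrightarrow> f t - f s \<le> e * (t - s)"
    by (metis DiffD1 DiffD2)
  define g where "g t = (if t \<in> N then U else if t \<in> {a..b} then ball t (\<rho> t) else UNIV)" for t
  have "gauge g"
    unfolding gauge_def g_def using \<rho>(1) U(1,2) by auto
  then obtain p where p: "p tagged_division_of {a..b}" "g fine p"
    using fine_division_exists_real by metis
  note pD = tagged_division_ofD[OF p(1)]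
  have K: "a \<le> Inf K" "Inf K \<le> t" "t \<le> Sup K" "Sup K \<le> b" "Inf K \<in> K" "Sup K \<in> K"
      "interior K = {Inf K<..<Sup K}" "{Inf K<..<Sup K} \<subseteq> K" if tK: "(t, K) \<in> p" for t K
  proof -
    obtain u v where uv: "K = {u..v}" using pD(4)[OF tK] by auto
    have "t \<in> K" "K \<subseteq> {a..b}" using pD(2,3)[OF tK] .
    then show "a \<le> Inf K" "Inf K \<le> t" "t \<le> Sup K" "Sup K \<le> b" "Inf K \<in> K" "Sup K \<in> K"
      "interior K = {Inf K<..<Sup K}" "{Inf K<..<Sup K} \<subseteq> K" using uv by auto
  qed
  define p1 where "p1 = {tK \<in> p. fst tK \<in> N}"
  have fin: "finite p" "finite p1" using pD(1) by (auto simp: p1_def)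
  have disj: "disjoint_family_on (\<lambda>tK. {Inf (snd tK)<..<Sup (snd tK)}) p1"
    unfolding disjoint_family_on_def
  proof (intro ballI impI)
    fix P Q assume 1: "P \<in> p1" "Q \<in> p1" "P \<noteq> Q"
    then have PQ: "(fst P, snd P) \<in> p" "(fst Q, snd Q) \<in> p" by (simp_all add: p1_def)
    then have "interior (snd P) \<inter> interior (snd Q) = {}" using 1(3) by (intro pD(5)[OF PQ]) simp
    then show "{Inf (snd P)<..<Sup (snd P)} \<inter> {Inf (snd Q)<..<Sup (snd Q)} = {}"
      unfolding K(7)[OF PQ(1)] K(7)[OF PQ(2)] .
  qed
  have "(\<Sum>tK\<in>p1. Sup (snd tK) - Inf (snd tK)) \<le> measure lebesgue U"
  proof (rule sum_length_le_measure[OF fin(2) disj _ _ U(3)])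
    fix tK assume tK: "tK \<in> p1"
    then have q: "(fst tK, snd tK) \<in> p" and "fst tK \<in> N" by (auto simp: p1_def)
    then have "snd tK \<subseteq> U" using fineD[OF p(2) q] by (simp add: g_def)
    then show "Inf (snd tK) \<le> Sup (snd tK)" "{Inf (snd tK)<..<Sup (snd tK)} \<subseteq> U"
      using K(2,3)[OF q] K(8)[OF q] by auto
  qed
  then have less: "(\<Sum>tK\<in>p1. norm (f (Sup (snd tK)) - f (Inf (snd tK)))) < e"
  proof (intro absolutely_continuous_fun_sum_less[OF d fin(2) _ disj])
    fix tK assume "tK \<in> p1"
    then have q: "(fst tK, snd tK) \<in> p" by (auto simp: p1_def)
    show "a \<le> Inf (snd tK) \<and> Inf (snd tK) \<le> Sup (snd tK) \<and> Sup (snd tK) \<le> b"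
      using K(1-4)[OF q] by auto
  qed (use U(4) in auto)
  let ?S = "\<lambda>p. \<Sum>tK\<in>p. f (Sup (snd tK)) - f (Inf (snd tK))"
  have "f b - f a = ?S p"
    using additive_tagged_division_1[OF \<open>a \<le> b\<close> p(1), of f] by (simp add: case_prod_beta')
  moreover have "?S p = ?S (p - p1) + ?S p1"
    using fin(1) by (intro sum.subset_diff) (auto simp: p1_def)
  moreover have "?S p1 \<le> (\<Sum>tK\<in>p1. norm (f (Sup (snd tK)) - f (Inf (snd tK))))"
    by (intro sum_mono) simp
  moreover have "?S (p - p1) \<le> (\<Sum>tK\<in>p - p1. e * (Sup (snd tK) - Inf (snd tK)))"
  proof (rule sum_mono)
    fix tK assume "tK \<in> p - p1"
    then obtain t K' where tK: "tK = (t, K')" "(t, K') \<in> p" "t \<notin> N" by (cases tK) (auto simp: p1_def)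
    note k = K[OF tK(2)]
    have t: "t \<in> {a..b}" using k(1-4) by auto
    have "K' \<subseteq> ball t (\<rho> t)" using fineD[OF p(2) tK(2)] tK(3) t by (simp add: g_def)
    then have "\<bar>Inf K' - t\<bar> < \<rho> t" "\<bar>Sup K' - t\<bar> < \<rho> t"
      using k(5,6) by (auto simp: subset_eq dist_real_def abs_minus_commute)
    then have "f (Sup K') - f t \<le> e * (Sup K' - t)" "f t - f (Inf K') \<le> e * (t - Inf K')"
      using \<rho>(2)[of t "Sup K'"] \<rho>(3)[of t "Inf K'"] k(1-4) t tK by auto
    then show "f (Sup (snd tK)) - f (Inf (snd tK)) \<le> e * (Sup (snd tK) - Inf (snd tK))"
      using tK by (simp add: algebra_simps)
  qed
  moreover have "(\<Sum>tK\<in>p - p1. e * (Sup (snd tK) - Inf (snd tK))) \<le> (\<Sum>tK\<in>p. e * (Sup (snd tK) - Inf (snd tK)))"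
  proof (rule sum_mono2[OF fin(1)])
    fix tK assume "tK \<in> p - (p - p1)"
    then have q: "(fst tK, snd tK) \<in> p" by auto
    show "0 \<le> e * (Sup (snd tK) - Inf (snd tK))" using K(2,3)[OF q] e by simp
  qed auto
  moreover have "(\<Sum>tK\<in>p. e * (Sup (snd tK) - Inf (snd tK))) = e * (b - a)"
    using additive_tagged_division_1[OF \<open>a \<le> b\<close> p(1), of "\<lambda>x. x"] by (simp add: case_prod_beta' flip: sum_distrib_left)
  ultimately show "f b \<le> f a + e0" using e_eq less by linarith
qed

lemma absolutely_continuous_fun_ident: "absolutely_continuous_fun a b (\<lambda>t::real. t)"
  unfolding absolutely_continuous_fun_def
proof (intro allI impI)
  fix e :: real assume "e > 0"
  have "(\<Sum>i<n. norm (r i - l i)) = (\<Sum>i<n. r i - l i)"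
    if "\<forall>i<n. a \<le> l i \<and> l i \<le> r i \<and> r i \<le> b" for n :: nat and l r :: "nat \<Rightarrow> real"
    using that by (intro sum.cong) auto
  with \<open>e > 0\<close> show "\<exists>d>0. \<forall>(n::nat) l r. (\<forall>i<n. a \<le> l i \<and> l i \<le> r i \<and> r i \<le> b) \<longrightarrow>
        disjoint_family_on (\<lambda>i. {l i<..<r i}) {..<n} \<longrightarrow>
        (\<Sum>i<n. r i - l i) < d \<longrightarrow> (\<Sum>i<n. norm (r i - l i)) < e"
    by (intro exI[of _ e]) simp
qed

text \<open>Common source of the closure properties below: sums, products and Lipschitz images all
  have increments controlled by those of two known functions.\<close>

lemma absolutely_continuous_fun_dominated:
  assumes g: "absolutely_continuous_fun a b g" and h: "absolutely_continuous_fun a b h"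
    and le: "\<And>s t. s \<in> {a..b} \<Longrightarrow> t \<in> {a..b} \<Longrightarrow> norm (f s - f t) \<le> C * (norm (g s - g t) + norm (h s - h t))"
  shows "absolutely_continuous_fun a b f"
  unfolding absolutely_continuous_fun_def
proof (intro allI impI)
  fix e :: real assume "e > 0"
  \<comment> \<open>\<open>e\<close> is shared between \<open>g\<close> and \<open>h\<close>;
    \<open>\<bar>C\<bar> + 1\<close> is positive whatever \<open>C\<close> is supplied.\<close>
  define e' where "e' = e / (2 * (\<bar>C\<bar> + 1))"
  have "e' > 0" using \<open>e > 0\<close> by (simp add: e'_def)
  moreover have "\<bar>C\<bar> + 1 \<noteq> 0" using abs_ge_zero[of C] by linarith
  then have "(\<bar>C\<bar> + 1) * (e' + e') = e" unfolding e'_def by (simp add: divide_simps)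
  ultimately have e': "e' > 0" "(\<bar>C\<bar> + 1) * (e' + e') = e" by blast+
  obtain d1 where d1: "d1 > 0" "\<forall>(n::nat) l r. (\<forall>i<n. a \<le> l i \<and> l i \<le> r i \<and> r i \<le> b) \<longrightarrow>
        disjoint_family_on (\<lambda>i. {l i<..<r i}) {..<n} \<longrightarrow>
        (\<Sum>i<n. r i - l i) < d1 \<longrightarrow> (\<Sum>i<n. norm (g (r i) - g (l i))) < e'"
    using g e'(1) unfolding absolutely_continuous_fun_def by blast
  obtain d2 where d2: "d2 > 0" "\<forall>(n::nat) l r. (\<forall>i<n. a \<le> l i \<and> l i \<le> r i \<and> r i \<le> b) \<longrightarrow>
        disjoint_family_on (\<lambda>i. {l i<..<r i}) {..<n} \<longrightarrow>
        (\<Sum>i<n. r i - l i) < d2 \<longrightarrow> (\<Sum>i<n. norm (h (r i) - h (l i))) < e'"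
    using h e'(1) unfolding absolutely_continuous_fun_def by blast
  show "\<exists>d>0. \<forall>(n::nat) l r. (\<forall>i<n. a \<le> l i \<and> l i \<le> r i \<and> r i \<le> b) \<longrightarrow>
        disjoint_family_on (\<lambda>i. {l i<..<r i}) {..<n} \<longrightarrow>
        (\<Sum>i<n. r i - l i) < d \<longrightarrow> (\<Sum>i<n. norm (f (r i) - f (l i))) < e"
  proof (intro exI[of _ "min d1 d2"] conjI allI impI)
    fix n :: nat and l r :: "nat \<Rightarrow> real"
    assume 1: "\<forall>i<n. a \<le> l i \<and> l i \<le> r i \<and> r i \<le> b"
        "disjoint_family_on (\<lambda>i. {l i<..<r i}) {..<n}" "(\<Sum>i<n. r i - l i) < min d1 d2"
    have "(\<Sum>i<n. norm (f (r i) - f (l i))) \<le> (\<Sum>i<n. (\<bar>C\<bar> + 1) * (norm (g (r i) - g (l i)) + norm (h (r i) - h (l i))))"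
    proof (rule sum_mono)
      fix i assume "i \<in> {..<n}"
      then have "r i \<in> {a..b}" "l i \<in> {a..b}" using 1(1) by force+
      from le[OF this] have "norm (f (r i) - f (l i)) \<le> C * (norm (g (r i) - g (l i)) + norm (h (r i) - h (l i)))" .
      also have "\<dots> \<le> (\<bar>C\<bar> + 1) * (norm (g (r i) - g (l i)) + norm (h (r i) - h (l i)))"
        by (intro mult_right_mono) auto
      finally show "norm (f (r i) - f (l i)) \<le> (\<bar>C\<bar> + 1) * (norm (g (r i) - g (l i)) + norm (h (r i) - h (l i)))" .
    qed
    also have "\<dots> = (\<bar>C\<bar> + 1) * ((\<Sum>i<n. norm (g (r i) - g (l i))) + (\<Sum>i<n. norm (h (r i) - h (l i))))"
      by (simp add: sum.distrib flip: sum_distrib_left)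
    also have "\<dots> < (\<bar>C\<bar> + 1) * (e' + e')"
      using d1(2)[rule_format, of n l r] d2(2)[rule_format, of n l r] 1 by (intro mult_strict_left_mono add_strict_mono) auto
    finally show "(\<Sum>i<n. norm (f (r i) - f (l i))) < e" using e'(2) by simp
  qed (use d1 d2 in auto)
qed

lemma absolutely_continuous_fun_add:
  assumes "absolutely_continuous_fun a b f" "absolutely_continuous_fun a b g"
  shows "absolutely_continuous_fun a b (\<lambda>t. f t + g t)"
  using assms
  by (rule absolutely_continuous_fun_dominated[where C = 1]) (simp only: mult_1 add_diff_add norm_triangle_ineq)

lemma bounded_bilinear_absolutely_continuous_fun:
  assumes "bounded_bilinear bil"
    and "absolutely_continuous_fun a b f" "absolutely_continuous_fun a b g"
    and "continuous_on {a..b} f" "continuous_on {a..b} g"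
  shows "absolutely_continuous_fun a b (\<lambda>t. bil (f t) (g t))"
proof -
  interpret bounded_bilinear bil by fact
  obtain K where K: "K > 0" "\<And>x y. norm (bil x y) \<le> norm x * norm y * K" using pos_bounded by blast
  obtain B1 where B1: "\<And>t. t \<in> {a..b} \<Longrightarrow> norm (f t) \<le> B1"
    using compact_imp_bounded[OF compact_continuous_image[OF assms(4) compact_Icc]] unfolding bounded_iff by blast
  obtain B2 where B2: "\<And>t. t \<in> {a..b} \<Longrightarrow> norm (g t) \<le> B2"
    using compact_imp_bounded[OF compact_continuous_image[OF assms(5) compact_Icc]] unfolding bounded_iff by blast
  define B where "B = max B1 B2"
  show ?thesis
  proof (rule absolutely_continuous_fun_dominated[OF assms(2,3), where C = "B * K"])
    fix s t assume st: "s \<in> {a..b}" "t \<in> {a..b}"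
    have B: "norm (f t) \<le> B" "norm (g s) \<le> B" using B1[OF st(2)] B2[OF st(1)] by (auto simp: B_def)
    have "bil (f s) (g s) - bil (f t) (g t) = bil (f s - f t) (g s) + bil (f t) (g s - g t)"
      by (simp add: diff_left diff_right)
    then have "norm (bil (f s) (g s) - bil (f t) (g t)) \<le> norm (f s - f t) * norm (g s) * K + norm (f t) * norm (g s - g t) * K"
      using order_trans[OF norm_triangle_ineq add_mono[OF K(2) K(2)]] by simp
    also have "\<dots> \<le> norm (f s - f t) * B * K + B * norm (g s - g t) * K"
      using B K(1) by (intro add_mono mult_right_mono mult_left_mono) auto
    finally show "norm (bil (f s) (g s) - bil (f t) (g t)) \<le> B * K * (norm (f s - f t) + norm (g s - g t))"
      by (simp add: algebra_simps)
  qed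
qed

lemma absolutely_continuous_fun_C1:
  fixes f :: "real \<Rightarrow> 'a::real_normed_vector"
  assumes "\<And>t. t \<in> {a..b} \<Longrightarrow> (f has_vector_derivative f' t) (at t within {a..b})"
    and "continuous_on {a..b} f'"
  shows "absolutely_continuous_fun a b f"
proof -
  obtain B where B: "\<And>t. t \<in> {a..b} \<Longrightarrow> norm (f' t) \<le> B"
    using compact_imp_bounded[OF compact_continuous_image[OF assms(2) compact_Icc]] unfolding bounded_iff by blast
  have lip: "norm (f s - f t) \<le> B * norm (s - t)" if "s \<in> {a..b}" "t \<in> {a..b}" for s t
  proof (rule differentiable_bound[of "{a..b}" f "\<lambda>t h. h *\<^sub>R f' t"])
    show "(f has_derivative (\<lambda>h. h *\<^sub>R f' r)) (at r within {a..b})" if "r \<in> {a..b}" for r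
      using assms(1)[OF that] by (simp add: has_vector_derivative_def)
    show "onorm (\<lambda>h. h *\<^sub>R f' r) \<le> B" if "r \<in> {a..b}" for r
      using B[OF that] by (intro onorm_le) (simp add: mult.commute[of B] mult_left_mono)
  qed (use that in auto)
  show ?thesis
    \<comment> \<open>\<open>B\<close> is halved because the identity is used as both dominating
      functions.\<close>
    by (rule absolutely_continuous_fun_dominated[OF absolutely_continuous_fun_ident absolutely_continuous_fun_ident, where C = "B / 2"])
      (use lip in simp)
qed

text \<open>Pairing with a fixed vector reduces a mean value estimate to the real-valued
  monotonicity lemma, which avoids integrating vector-valued functions. Continuity of
  \<open>g\<close> then makes the estimate local.\<close>

lemma absolutely_continuous_has_vector_derivative:
  fixes f g :: "real \<Rightarrow> 'a::real_inner"
  assumes ac: "\<And>a b. t0 \<le> a \<Longrightarrow> a \<le> b \<Longrightarrow> absolutely_continuous_fun a b f"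
    and N: "negligible N"
    and deriv: "\<And>t. t > t0 \<Longrightarrow> t \<notin> N \<Longrightarrow> (f has_vector_derivative g t) (at t)"
    and g: "\<And>t. t > t0 \<Longrightarrow> isCont g t" and t: "t > t0"
  shows "(f has_vector_derivative g t) (at t)"
proof -
  have inc: "norm (f s2 - f s1 - (s2 - s1) *\<^sub>R v) \<le> e * (s2 - s1)"
    if s: "t0 < s1" "s1 \<le> s2" and v: "\<And>r. r \<in> {s1..s2} \<Longrightarrow> norm (g r - v) \<le> e" for s1 s2 v and e :: real
  proof -
    \<comment> \<open>The test vector is the error itself: the increment of \<open>h\<close> becomes
      \<open>|u|\<^sup>2 - (s2 - s1) * e * |u|\<close>, and its nonpositivity is the desired bound
      after division by \<open>|u|\<close>.\<close>
    define u where "u = f s2 - f s1 - (s2 - s1) *\<^sub>R v"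
    define h where "h r = (f r - r *\<^sub>R v) \<bullet> u - r * (e * norm u)" for r
    have "h s2 \<le> h s1"
    proof (rule absolutely_continuous_deriv_nonpos_decreasing[OF _ s(2) N])
      show "absolutely_continuous_fun s1 s2 h"
      proof (rule absolutely_continuous_fun_dominated[OF ac absolutely_continuous_fun_ident, where C = "norm u * (1 + norm v + \<bar>e\<bar>)"])
        fix r q
        have "h r - h q = (f r - f q) \<bullet> u - (r - q) * (v \<bullet> u + e * norm u)"
          by (simp add: h_def inner_simps algebra_simps)
        then have "norm (h r - h q) \<le> \<bar>(f r - f q) \<bullet> u\<bar> + \<bar>r - q\<bar> * \<bar>v \<bullet> u + e * norm u\<bar>"
          by (metis abs_mult abs_triangle_ineq4 real_norm_def)
        also have "\<dots> \<le> norm (f r - f q) * norm u + \<bar>r - q\<bar> * (norm v * norm u + \<bar>e\<bar> * norm u)"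
          by (intro add_mono Cauchy_Schwarz_ineq2 mult_left_mono order_trans[OF abs_triangle_ineq]) (auto simp: abs_mult)
        also have "\<dots> \<le> norm u * (1 + norm v + \<bar>e\<bar>) * (norm (f r - f q) + norm (r - q))"
          by (simp add: algebra_simps)
        finally show "norm (h r - h q) \<le> norm u * (1 + norm v + \<bar>e\<bar>) * (norm (f r - f q) + norm (r - q))" .
      qed (use s in auto)
    next
      fix r assume r: "r \<in> {s1..s2} - N"
      then have d: "(f has_vector_derivative g r) (at r within {s1..s2})"
        using deriv[of r] s by (auto intro: has_vector_derivative_at_within)
      have "(h has_real_derivative (g r - v) \<bullet> u - e * norm u) (at r within {s1..s2})"
        unfolding h_def has_real_derivative_iff_has_vector_derivative
        by (rule derivative_eq_intros bounded_linear.has_vector_derivative[OF bounded_linear_inner_left] d refl | simp)+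
      moreover have "(g r - v) \<bullet> u \<le> e * norm u"
        using order_trans[OF norm_cauchy_schwarz mult_right_mono[OF v[of r]]] r by simp
      ultimately show "\<exists>D\<le>0. (h has_real_derivative D) (at r within {s1..s2})"
        by (intro exI[of _ "(g r - v) \<bullet> u - e * norm u"]) simp
    qed
    moreover have "h s2 - h s1 = u \<bullet> u - (s2 - s1) * (e * norm u)"
    proof -
      have "h s2 - h s1 = (f s2 - f s1 - (s2 - s1) *\<^sub>R v) \<bullet> u - (s2 - s1) * (e * norm u)"
        unfolding h_def by (simp add: inner_diff_left algebra_simps)
      then show ?thesis unfolding u_def[symmetric] .
    qed
    ultimately have "norm u * norm u \<le> (e * (s2 - s1)) * norm u"
      by (simp add: dot_square_norm power2_eq_square algebra_simps)
    moreover have "0 \<le> e" using order_trans[OF norm_ge_zero v[of s1]] s by simp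
    ultimately have "norm u \<le> e * (s2 - s1)" using s by (cases "u = 0") auto
    then show ?thesis unfolding u_def .
  qed
  show ?thesis
    unfolding has_vector_derivative_def has_derivative_at_alt
  proof (intro conjI allI impI bounded_linear_scaleR_left)
    fix e :: real assume "e > 0"
    then obtain d where d: "d > 0" "\<And>r. \<bar>r - t\<bar> < d \<Longrightarrow> norm (g r - g t) < e"
      using g[OF t] unfolding continuous_at_eps_delta by (metis dist_norm real_norm_def)
    show "\<exists>d>0. \<forall>y. norm (y - t) < d \<longrightarrow> norm (f y - f t - (y - t) *\<^sub>R g t) \<le> e * norm (y - t)"
    proof (intro exI[of _ "min d (t - t0)"] conjI allI impI)
      fix y assume y: "norm (y - t) < min d (t - t0)"
      have near: "norm (g r - g t) \<le> e" if "r \<in> {min y t..max y t}" for r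
        using d(2)[of r] that y by (auto split: if_splits simp: min_def max_def)
      show "norm (f y - f t - (y - t) *\<^sub>R g t) \<le> e * norm (y - t)"
      proof (cases "y \<ge> t")
        case True
        then show ?thesis using inc[of t y "g t" e] near t by simp
      next
        case False
        then have "norm (f t - f y - (t - y) *\<^sub>R g t) \<le> e * (t - y)"
          using inc[of y t "g t" e] near y by simp
        moreover have "f t - f y - (t - y) *\<^sub>R g t = - (f y - f t - (y - t) *\<^sub>R g t)"
          by (simp add: algebra_simps)
        ultimately show ?thesis using False by (simp only: norm_minus_cancel) simp
      qed
    qed (use d t in auto)
  qed
qed

section \<open>Monotone limits and integrability on half lines\<close>

lemma decreasing_bounded_below_convergent_at_top:
  fixes g :: "real \<Rightarrow> real"
  assumes dec: "\<And>s t. T \<le> s \<Longrightarrow> s \<le> t \<Longrightarrow> g t \<le> g s" and bnd: "\<And>t. T \<le> t \<Longrightarrow> b \<le> g t"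
  shows "\<exists>l. (g \<longlongrightarrow> l) at_top"
proof
  let ?l = "INF t\<in>{T..}. g t"
  have bdd: "bdd_below (g ` {T..})" using bnd by (auto intro!: bdd_belowI)
  show "(g \<longlongrightarrow> ?l) at_top"
  proof (rule decreasing_tendsto)
    show "\<forall>\<^sub>F t in at_top. ?l \<le> g t"
      using eventually_ge_at_top[of T] by eventually_elim (auto intro!: cINF_lower bdd)
    fix r assume "?l < r"
    then obtain s where s: "s \<ge> T" "g s < r" using cINF_less_iff[OF _ bdd] by auto
    show "\<forall>\<^sub>F t in at_top. g t < r"
      using eventually_ge_at_top[of s] by eventually_elim (use dec s in \<open>auto intro: le_less_trans\<close>)
  qed
qed

lemma deriv_nonneg_mono_from:
  fixes h h' :: "real \<Rightarrow> real"
  assumes "\<And>t. T \<le> t \<Longrightarrow> (h has_real_derivative h' t) (at t)" "\<And>t. T \<le> t \<Longrightarrow> 0 \<le> h' t" "T \<le> s" "s \<le> t"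
  shows "h s \<le> h t"
proof (rule DERIV_nonneg_imp_nondecreasing[OF assms(4)])
  fix r assume "s \<le> r"
  then have "T \<le> r" using assms(3) by linarith
  then show "\<exists>d. (h has_real_derivative d) (at r) \<and> 0 \<le> d" using assms(1,2) by blast
qed

text \<open>The decrease of \<open>f - C * I\<close> is assumed instead of an inequality for the
  derivative of \<open>f\<close>, so that functions differentiable only almost everywhere are
  covered.\<close>

lemma tendsto_zero_of_integrable_rate:
  fixes f q I :: "real \<Rightarrow> real"
  assumes T: "T > 0" and I: "\<And>t. T \<le> t \<Longrightarrow> (I has_real_derivative q t) (at t)"
    and q: "\<And>t. T \<le> t \<Longrightarrow> 0 \<le> q t" and B: "\<And>t. T \<le> t \<Longrightarrow> I t \<le> B"
    and dec: "\<And>s t. T \<le> s \<Longrightarrow> s \<le> t \<Longrightarrow> f t - C * I t \<le> f s - C * I s" and "C \<ge> 0"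
    and f: "\<And>t. T \<le> t \<Longrightarrow> 0 \<le> f t" "\<And>t. T \<le> t \<Longrightarrow> f t \<le> K * (t * q t)" and "K > 0"
  shows "(f \<longlongrightarrow> 0) at_top"
proof -
  have "I s \<le> I t" if "T \<le> s" "s \<le> t" for s t
    using deriv_nonneg_mono_from[OF I q that] .
  then obtain k where "((\<lambda>t. - I t) \<longlongrightarrow> k) at_top"
    using decreasing_bounded_below_convergent_at_top[of T "\<lambda>t. - I t" "- B"] B by auto
  moreover have "- (C * B) \<le> f t - C * I t" if "T \<le> t" for t
    using f(1)[OF that] mult_left_mono[OF B[OF that] \<open>C \<ge> 0\<close>] by linarith
  then obtain k' where "((\<lambda>t. f t - C * I t) \<longlongrightarrow> k') at_top"
    using decreasing_bounded_below_convergent_at_top[of T "\<lambda>t. f t - C * I t", OF dec] by blast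
  ultimately have "((\<lambda>t. (f t - C * I t) - C * (- I t)) \<longlongrightarrow> k' - C * k) at_top"
    by (intro tendsto_intros)
  then obtain l where l: "(f \<longlongrightarrow> l) at_top" by auto
  have "l \<ge> 0"
    by (rule tendsto_lowerbound[OF l]) (use f(1) in \<open>auto simp: eventually_at_top_linorder\<close>)
  moreover have "\<not> l > 0"
  proof
    assume "l > 0"
    then have "\<forall>\<^sub>F t in at_top. l / 2 < f t" using l by (intro order_tendstoD(1)) auto
    then obtain T' where T': "\<And>t. T' \<le> t \<Longrightarrow> l / 2 < f t" by (auto simp: eventually_at_top_linorder)
    define R where "R = max T T'"
    \<comment> \<open>Once \<open>f\<close> exceeds \<open>l / 2\<close>, the bound
      \<open>K * (t * q t)\<close> gives \<open>q t \<ge> c / t\<close>, so \<open>I\<close> grows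
      at least like \<open>c * ln t\<close>.\<close>
    define c where "c = l / (2 * K)"
    have c: "c > 0" "K * c = l / 2" using \<open>l > 0\<close> \<open>K > 0\<close> by (auto simp: c_def)
    have le: "I R - c * ln R \<le> I t - c * ln t" if "R \<le> t" for t
    proof (rule deriv_nonneg_mono_from[OF _ _ order_refl that])
      fix r assume r: "R \<le> r"
      then have r': "T \<le> r" "T' \<le> r" "r > 0" using T by (auto simp: R_def)
      show "((\<lambda>t. I t - c * ln t) has_real_derivative q r - c * (1 / r)) (at r)"
        by (rule derivative_eq_intros I r' refl | use r' in simp)+
      have "K * c \<le> K * (r * q r)" using T'[OF r'(2)] f(2)[OF r'(1)] c(2) by linarith
      then have "c \<le> q r * r" using \<open>K > 0\<close> by (simp add: mult.commute)
      then show "0 \<le> q r - c * (1 / r)" using r'(3) by (simp add: pos_divide_le_eq)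
    qed
    have "filterlim (\<lambda>t. (I R - c * ln R) + c * ln t) at_top at_top"
      by (intro filterlim_tendsto_add_at_top[OF tendsto_const] filterlim_tendsto_pos_mult_at_top[OF tendsto_const c(1)] ln_at_top)
    then have "\<forall>\<^sub>F t in at_top. B < (I R - c * ln R) + c * ln t"
      by (simp add: filterlim_at_top_dense)
    then obtain t where "B < (I R - c * ln R) + c * ln t" "t \<ge> R"
      using eventually_happens'[OF _ eventually_conj[OF _ eventually_ge_at_top[of R]]] by force
    then show False using le[of t] B[of t] by (simp add: R_def)
  qed
  ultimately show ?thesis using l by simp
qed

text \<open>The antiderivative is available only from \<open>T\<close> on, where the fundamental
  theorem on a half line applies; on the remaining compact piece continuity suffices.\<close>

lemma set_integrable_atLeast_nonneg:
  fixes q I :: "real \<Rightarrow> real"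
  assumes cont: "continuous_on {t0..} q" and q: "\<And>t. t0 \<le> t \<Longrightarrow> 0 \<le> q t" and "t0 \<le> T"
    and I: "\<And>t. T \<le> t \<Longrightarrow> (I has_real_derivative q t) (at t)" and B: "\<And>t. T \<le> t \<Longrightarrow> I t \<le> B"
  shows "set_integrable lborel {t0..} q"
proof -
  have "I s \<le> I t" if "T \<le> s" "s \<le> t" for s t
    using deriv_nonneg_mono_from[OF I q that] \<open>t0 \<le> T\<close> by simp
  then obtain k where "((\<lambda>t. - I t) \<longlongrightarrow> k) at_top"
    using decreasing_bounded_below_convergent_at_top[of T "\<lambda>t. - I t" "- B"] B by auto
  from tendsto_minus[OF this] have lim: "(I \<longlongrightarrow> - k) at_top" by simp
  define f where "f t = indicator {T..} t *\<^sub>R q t" for t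
  have f_borel: "f \<in> borel_measurable borel"
    unfolding f_def
    by (rule borel_measurable_continuous_on_indicator[OF _ continuous_on_subset[OF cont]]) (use \<open>t0 \<le> T\<close> in auto)
  have "(\<integral>\<^sup>+x. ennreal (f x) * indicator {T..} x \<partial>lborel) = ennreal (- k - I T)"
    by (rule nn_integral_FTC_atLeast[OF f_borel _ _ lim]) (use I q \<open>t0 \<le> T\<close> in \<open>auto simp: f_def\<close>)
  moreover have "(\<lambda>x. ennreal (f x) * indicator {T..} x) = (\<lambda>x. ennreal (f x))"
    by (auto simp: f_def indicator_def)
  ultimately have "(\<integral>\<^sup>+x. ennreal (f x) \<partial>lborel) < \<infinity>" by simp
  then have "integrable lborel f"
    using f_borel q \<open>t0 \<le> T\<close> by (intro integrableI_nonneg) (auto simp: f_def indicator_def)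
  then have "set_integrable lborel {T..} q" unfolding set_integrable_def f_def .
  have "set_integrable lborel {t0..T} q"
    unfolding set_integrable_def
    by (rule borel_integrable_compact[OF compact_Icc continuous_on_subset[OF cont]]) auto
  then have "set_integrable lborel ({t0..T} \<union> {T..}) q"
    using \<open>set_integrable lborel {T..} q\<close> by (rule set_integrable_Un) auto
  moreover have "{t0..T} \<union> {T..} = {t0..}" using \<open>t0 \<le> T\<close> by auto
  ultimately show ?thesis by simp
qed

section \<open>The trajectory\<close>

text \<open>Lets an inequality between norms of increments pass to norms of derivatives.\<close>

lemma has_vector_derivative_norm_quotient:
  assumes "(f has_vector_derivative D) (at t)"
  shows "((\<lambda>s. norm (f s - f t) / \<bar>s - t\<bar>) \<longlongrightarrow> norm D) (at t)"
proof -
  have 0: "((\<lambda>s. (f s - f t - (s - t) *\<^sub>R D) /\<^sub>R norm (s - t)) \<longlongrightarrow> 0) (at t)"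
    using assms by (simp add: has_vector_derivative_def has_derivative_at_within)
  have "((\<lambda>s. norm (f s - f t) / \<bar>s - t\<bar> - norm D) \<longlongrightarrow> 0) (at t)"
  proof (rule Lim_null_comparison[OF _ tendsto_norm_zero[OF 0]])
    show "\<forall>\<^sub>F s in at t. norm (norm (f s - f t) / \<bar>s - t\<bar> - norm D) \<le> norm ((f s - f t - (s - t) *\<^sub>R D) /\<^sub>R norm (s - t))"
      unfolding eventually_at_filter
    proof (rule always_eventually, intro allI impI)
      fix s assume "s \<noteq> t"
      then have "norm (f s - f t) / \<bar>s - t\<bar> - norm D = (norm (f s - f t) - norm ((s - t) *\<^sub>R D)) / \<bar>s - t\<bar>"
        by (simp add: diff_divide_distrib)
      also have "norm \<dots> \<le> norm (f s - f t - (s - t) *\<^sub>R D) / \<bar>s - t\<bar>"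
        using norm_triangle_ineq3[of "f s - f t" "(s - t) *\<^sub>R D"] by (simp add: divide_right_mono)
      finally show "norm (norm (f s - f t) / \<bar>s - t\<bar> - norm D) \<le> norm ((f s - f t - (s - t) *\<^sub>R D) /\<^sub>R norm (s - t))"
        by (simp add: divide_inverse mult.commute)
    qed
  qed
  then show ?thesis by (simp add: LIM_zero_iff)
qed

lemma C1_fromD:
  assumes "C1_from t0 f f'"
  shows "\<And>t. t0 < t \<Longrightarrow> (f has_vector_derivative f' t) (at t)"
    and "continuous_on {t0..} f" and "continuous_on {t0..} f'"
    and "\<And>a b. t0 \<le> a \<Longrightarrow> absolutely_continuous_fun a b f"
proof -
  have d: "(f has_vector_derivative f' t) (at t within {t0..})" if "t0 \<le> t" for t
    using assms that by (auto simp: C1_from_def)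
  show c: "continuous_on {t0..} f'" using assms by (auto simp: C1_from_def)
  show "(f has_vector_derivative f' t) (at t)" if "t0 < t" for t
    using d[of t] that at_within_interior[of t "{t0..}"] by simp
  show "continuous_on {t0..} f"
    using d by (intro continuous_on_vector_derivative) auto
  show "absolutely_continuous_fun a b f" if "t0 \<le> a" for a b
  proof (rule absolutely_continuous_fun_C1)
    show "(f has_vector_derivative f' t) (at t within {a..b})" if "t \<in> {a..b}" for t
      by (rule has_vector_derivative_within_subset[OF d]) (use that \<open>t0 \<le> a\<close> in auto)
    show "continuous_on {a..b} f'"
      by (rule continuous_on_subset[OF c]) (use that in auto)
  qed
qed

lemma continuous_on_atLeast_isCont:
  fixes f :: "real \<Rightarrow> 'a::topological_space"
  shows "continuous_on {t0..} f \<Longrightarrow> t0 < t \<Longrightarrow> isCont f t"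
  by (rule continuous_on_interior) auto

section \<open>Regularity along the trajectory and the first-order form of the equation\<close>

locale yosida_flow =
  fixes A :: "'a::{real_inner,complete_space} \<Rightarrow> 'a set"
    and \<alpha> \<beta> t0 :: real and \<delta> \<delta>' \<gamma> \<gamma>' :: "real \<Rightarrow> real" and x x' :: "real \<Rightarrow> 'a"
  assumes A: "maximally_monotone A" and t0: "t0 > 0"
    and \<delta>: "C1_from t0 \<delta> \<delta>'" and \<delta>_pos: "\<And>t. t0 \<le> t \<Longrightarrow> \<delta> t > 0"
    and \<gamma>: "C1_from t0 \<gamma> \<gamma>'" and \<gamma>_pos: "\<And>t. t0 \<le> t \<Longrightarrow> \<gamma> t > 0"
    and sol: "solution_trajectory A \<alpha> \<beta> \<delta> \<gamma> t0 x x'"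
begin

definition a :: "real \<Rightarrow> 'a" where "a t = yosida A (\<gamma> t) (x t)"

definition p :: "real \<Rightarrow> 'a" where "p t = \<delta> t *\<^sub>R a t"

definition w :: "real \<Rightarrow> 'a" where "w t = t *\<^sub>R x' t + (t * \<beta>) *\<^sub>R p t"

lemma x: "C1_from t0 x x'" and x'_ac: "t0 \<le> b \<Longrightarrow> b \<le> c \<Longrightarrow> absolutely_continuous_fun b c x'"
  using sol by (auto simp: solution_trajectory_def locally_absolutely_continuous_from_def)

lemmas x_deriv = C1_fromD(1)[OF x] and x_cont = C1_fromD(2)[OF x] and x'_cont = C1_fromD(3)[OF x]
  and \<delta>_cont = C1_fromD(2)[OF \<delta>] and \<gamma>_cont = C1_fromD(2)[OF \<gamma>]

lemma a_diff:
  assumes "t0 \<le> s" "t0 \<le> t"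
  shows "\<gamma> s * norm (a s - a t) \<le> norm (x s - x t) + \<bar>\<gamma> t - \<gamma> s\<bar> * norm (a t)"
  unfolding a_def using assms by (intro yosida_norm_diff[OF A] \<gamma>_pos)

lemma a_cont: "continuous_on {t0..} a"
  unfolding continuous_on_def
proof
  fix t assume t: "t \<in> {t0..}"
  have x: "(x \<longlongrightarrow> x t) (at t within {t0..})" and g: "(\<gamma> \<longlongrightarrow> \<gamma> t) (at t within {t0..})"
    using x_cont \<gamma>_cont t by (auto simp: continuous_on_def)
  have "((\<lambda>s. (norm (x s - x t) + \<bar>\<gamma> t - \<gamma> s\<bar> * norm (a t)) / \<gamma> s) \<longlongrightarrow> (norm (x t - x t) + \<bar>\<gamma> t - \<gamma> t\<bar> * norm (a t)) / \<gamma> t) (at t within {t0..})"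
    by (intro tendsto_intros x g) (use \<gamma>_pos[of t] t in auto)
  then have *: "((\<lambda>s. (norm (x s - x t) + \<bar>\<gamma> t - \<gamma> s\<bar> * norm (a t)) / \<gamma> s) \<longlongrightarrow> 0) (at t within {t0..})"
    by simp
  have "((\<lambda>s. a s - a t) \<longlongrightarrow> 0) (at t within {t0..})"
  proof (rule Lim_null_comparison[OF _ *])
    show "\<forall>\<^sub>F s in at t within {t0..}. norm (a s - a t) \<le> (norm (x s - x t) + \<bar>\<gamma> t - \<gamma> s\<bar> * norm (a t)) / \<gamma> s"
      unfolding eventually_at_filter
      using a_diff \<gamma>_pos t by (intro always_eventually) (auto simp: pos_le_divide_eq mult.commute)
  qed
  then show "(a \<longlongrightarrow> a t) (at t within {t0..})" by (simp add: LIM_zero_iff)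
qed

lemma p_cont: "continuous_on {t0..} p"
  unfolding p_def by (intro continuous_intros a_cont \<delta>_cont)

lemma a_ac:
  assumes "t0 \<le> b" "b \<le> c"
  shows "absolutely_continuous_fun b c a"
proof -
  have sub: "{b..c} \<subseteq> {t0..}" using assms by auto
  obtain B where B: "\<And>t. t \<in> {b..c} \<Longrightarrow> norm (a t) \<le> B"
    using compact_imp_bounded[OF compact_continuous_image[OF continuous_on_subset[OF a_cont sub] compact_Icc]]
    unfolding bounded_iff by blast
  obtain r where r: "r \<in> {b..c}" "\<And>t. t \<in> {b..c} \<Longrightarrow> \<gamma> r \<le> \<gamma> t"
    using continuous_attains_inf[OF compact_Icc _ continuous_on_subset[OF \<gamma>_cont sub]] assms(2) by auto
  have pos: "\<gamma> r > 0" using r(1) sub \<gamma>_pos by auto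
  show ?thesis
  \<comment> \<open>On the compact interval \<open>\<gamma> r\<close> is the least index and
    \<open>B\<close> bounds \<open>a\<close>, which turns the two-index Yosida estimate into
    domination by \<open>x\<close> and \<gamma>.\<close>
  proof (rule absolutely_continuous_fun_dominated[OF C1_fromD(4)[OF x] C1_fromD(4)[OF \<gamma>], where C = "(1 + B) / \<gamma> r"])
    fix s t assume st: "s \<in> {b..c}" "t \<in> {b..c}"
    have "\<gamma> r * norm (a s - a t) \<le> \<gamma> s * norm (a s - a t)"
      using r(2)[OF st(1)] by (intro mult_right_mono) auto
    also have "\<dots> \<le> norm (x s - x t) + \<bar>\<gamma> t - \<gamma> s\<bar> * norm (a t)"
      using a_diff[of s t] st sub by auto
    also have "\<dots> \<le> norm (x s - x t) + norm (\<gamma> s - \<gamma> t) * B"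
      using B[OF st(2)] by (intro add_left_mono mult_mono) (auto simp: abs_minus_commute)
    also have "\<dots> \<le> (1 + B) * (norm (x s - x t) + norm (\<gamma> s - \<gamma> t))"
      using order_trans[OF norm_ge_zero B[OF st(1)]] by (simp add: algebra_simps)
    finally show "norm (a s - a t) \<le> (1 + B) / \<gamma> r * (norm (x s - x t) + norm (\<gamma> s - \<gamma> t))"
      using pos by (simp add: field_simps)
  qed (use assms in auto)
qed

lemma p_ac:
  assumes "t0 \<le> b" "b \<le> c"
  shows "absolutely_continuous_fun b c p"
proof -
  have sub: "{b..c} \<subseteq> {t0..}" using assms by auto
  show ?thesis
    unfolding p_def
    by (rule bounded_bilinear_absolutely_continuous_fun[OF bounded_bilinear_scaleR C1_fromD(4)[OF \<delta> assms(1)] a_ac[OF assms]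
          continuous_on_subset[OF \<delta>_cont sub] continuous_on_subset[OF a_cont sub]])
qed

lemma w_ac:
  assumes "t0 \<le> b" "b \<le> c"
  shows "absolutely_continuous_fun b c w"
proof -
  have sub: "{b..c} \<subseteq> {t0..}" using assms by auto
  have lin: "absolutely_continuous_fun b c (\<lambda>t. t * k)" for k :: real
    by (rule absolutely_continuous_fun_C1[where f' = "\<lambda>_. k"]) (auto intro!: derivative_eq_intros)
  \<comment> \<open>The factor \<open>1\<close> lets \<open>lin\<close> serve both summands, with
    \<open>k = 1\<close> and \<open>k = \<beta>\<close>.\<close>
  have "absolutely_continuous_fun b c (\<lambda>t. (t * 1) *\<^sub>R x' t)"
    by (rule bounded_bilinear_absolutely_continuous_fun[OF bounded_bilinear_scaleR lin x'_ac[OF assms]])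
      (auto intro!: continuous_intros continuous_on_subset[OF x'_cont sub])
  moreover have "absolutely_continuous_fun b c (\<lambda>t. (t * \<beta>) *\<^sub>R p t)"
    by (rule bounded_bilinear_absolutely_continuous_fun[OF bounded_bilinear_scaleR lin p_ac[OF assms]])
      (auto intro!: continuous_intros continuous_on_subset[OF p_cont sub])
  ultimately have "absolutely_continuous_fun b c (\<lambda>t. (t * 1) *\<^sub>R x' t + (t * \<beta>) *\<^sub>R p t)"
    by (rule absolutely_continuous_fun_add)
  then show ?thesis unfolding w_def by simp
qed

lemma ode_outside_negligible:
  "\<exists>N. negligible N \<and> (\<forall>t. t0 < t \<longrightarrow> t \<notin> N \<longrightarrow> (\<exists>x2 D. (x' has_vector_derivative x2) (at t) \<and>
      (p has_vector_derivative D) (at t) \<and>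
      x2 + (\<alpha> / t) *\<^sub>R x' t + \<beta> *\<^sub>R D + (1 + \<beta> / t) *\<^sub>R p t = 0))"
proof -
  have "AE t in lborel. t0 \<le> t \<longrightarrow>
      (\<exists>x2 D. (x' has_vector_derivative x2) (at t within {t0..}) \<and>
         (p has_vector_derivative D) (at t within {t0..}) \<and>
         x2 + (\<alpha> / t) *\<^sub>R x' t + \<beta> *\<^sub>R D + (1 + \<beta> / t) *\<^sub>R p t = 0)"
    using sol unfolding solution_trajectory_def p_def[abs_def] a_def by simp
  then obtain N where N: "\<And>t. t \<in> space lborel - N \<Longrightarrow> t0 \<le> t \<longrightarrow>
      (\<exists>x2 D. (x' has_vector_derivative x2) (at t within {t0..}) \<and>
         (p has_vector_derivative D) (at t within {t0..}) \<and>
         x2 + (\<alpha> / t) *\<^sub>R x' t + \<beta> *\<^sub>R D + (1 + \<beta> / t) *\<^sub>R p t = 0)"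
    and null: "N \<in> null_sets lborel"
    by (rule AE_E3) blast
  have "negligible N"
    using null_sets_completionI[OF null] by (simp add: negligible_iff_null_sets)
  moreover have "\<exists>x2 D. (x' has_vector_derivative x2) (at t) \<and> (p has_vector_derivative D) (at t) \<and>
      x2 + (\<alpha> / t) *\<^sub>R x' t + \<beta> *\<^sub>R D + (1 + \<beta> / t) *\<^sub>R p t = 0" if "t0 < t" "t \<notin> N" for t
  proof -
    have "at t within {t0..} = at t" using that(1) by (intro at_within_interior) simp
    then show ?thesis using N[of t] that by simp
  qed
  ultimately show ?thesis by blast
qed

text \<open>The second derivative of \<open>x\<close> and the derivative of \<open>p\<close> exist only almost everywhere, but in
  \<open>w\<close> they combine to a continuous function, so \<open>w\<close> is \<open>C\<^sup>1\<close>.\<close>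
lemma w_deriv:
  assumes t: "t0 < t"
  shows "(w has_vector_derivative ((1 - \<alpha>) *\<^sub>R x' t - t *\<^sub>R p t)) (at t)"
proof -
  obtain N where N: "negligible N"
    and ode: "\<And>t. t0 < t \<Longrightarrow> t \<notin> N \<Longrightarrow> \<exists>x2 D. (x' has_vector_derivative x2) (at t) \<and>
      (p has_vector_derivative D) (at t) \<and>
      x2 + (\<alpha> / t) *\<^sub>R x' t + \<beta> *\<^sub>R D + (1 + \<beta> / t) *\<^sub>R p t = 0"
    using ode_outside_negligible by blast
  show ?thesis
  proof (rule absolutely_continuous_has_vector_derivative[OF w_ac N _ _ t])
    fix t assume "t0 < t" "t \<notin> N"
    with t0 have "t \<noteq> 0" by auto
    from ode[OF \<open>t0 < t\<close> \<open>t \<notin> N\<close>] obtain x2 D where x2: "(x' has_vector_derivative x2) (at t)"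
      and D: "(p has_vector_derivative D) (at t)"
      and eq: "x2 + (\<alpha> / t) *\<^sub>R x' t + \<beta> *\<^sub>R D + (1 + \<beta> / t) *\<^sub>R p t = 0"
      by blast
    have "(w has_vector_derivative (t *\<^sub>R x2 + x' t + ((t * \<beta>) *\<^sub>R D + \<beta> *\<^sub>R p t))) (at t)"
      unfolding w_def[abs_def]
      by (rule derivative_eq_intros has_vector_derivative_scaleR x2 D refl | simp add: has_real_derivative_iff_has_vector_derivative)+
    also have "t *\<^sub>R x2 + x' t + ((t * \<beta>) *\<^sub>R D + \<beta> *\<^sub>R p t) = (1 - \<alpha>) *\<^sub>R x' t - t *\<^sub>R p t"
    proof -
      \<comment> \<open>Multiplication by \<open>t\<close> turns \<open>1 + \<beta> / t\<close> into
        \<open>t + \<beta>\<close>. The part \<open>\<beta> p\<close> is what the product rule for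
        \<open>t \<beta> p\<close> produces, so only \<open>- t p\<close> remains.\<close>
      have "t *\<^sub>R (x2 + (\<alpha> / t) *\<^sub>R x' t + \<beta> *\<^sub>R D + (1 + \<beta> / t) *\<^sub>R p t) = 0" using eq by simp
      then have "t *\<^sub>R x2 + \<alpha> *\<^sub>R x' t + (t * \<beta>) *\<^sub>R D + (t + \<beta>) *\<^sub>R p t = 0"
        using \<open>t \<noteq> 0\<close> by (simp add: scaleR_add_right distrib_left)
      then have "t *\<^sub>R x2 + x' t + ((t * \<beta>) *\<^sub>R D + \<beta> *\<^sub>R p t) - ((1 - \<alpha>) *\<^sub>R x' t - t *\<^sub>R p t) = 0"
        by (simp add: algebra_simps)
      then show ?thesis by simp
    qed
    finally show "(w has_vector_derivative ((1 - \<alpha>) *\<^sub>R x' t - t *\<^sub>R p t)) (at t)" .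
  next
    fix t assume "t0 < t"
    then show "isCont (\<lambda>t. (1 - \<alpha>) *\<^sub>R x' t - t *\<^sub>R p t) t"
      by (intro continuous_on_atLeast_isCont[of t0] continuous_intros x'_cont p_cont)
  qed
qed

text \<open>No chain rule is available for the Yosida approximation. The two-index estimate is
  divided by \<open>|s - t|\<close> instead, and the limit is taken at a point where
  \<open>D\<close> exists.\<close>

lemma p_deriv_bound:
  assumes t: "t0 < t" and D: "(p has_vector_derivative D) (at t)"
  shows "norm D \<le> \<delta> t / \<gamma> t * (norm (x' t) + \<bar>\<gamma>' t\<bar> * norm (a t)) + \<bar>\<delta>' t\<bar> * norm (a t)"
proof (rule tendsto_le[OF _ _ has_vector_derivative_norm_quotient[OF D]])
  have c: "isCont \<delta> t" "isCont \<gamma> t"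
    using continuous_on_atLeast_isCont \<delta>_cont \<gamma>_cont t by blast+
  have g: "((\<lambda>s. \<bar>\<gamma> s - \<gamma> t\<bar> / \<bar>s - t\<bar>) \<longlongrightarrow> \<bar>\<gamma>' t\<bar>) (at t)" "((\<lambda>s. \<bar>\<delta> s - \<delta> t\<bar> / \<bar>s - t\<bar>) \<longlongrightarrow> \<bar>\<delta>' t\<bar>) (at t)"
    using has_vector_derivative_norm_quotient[OF C1_fromD(1)[OF \<gamma> t]] has_vector_derivative_norm_quotient[OF C1_fromD(1)[OF \<delta> t]] by simp_all
  show "((\<lambda>s. \<delta> s / \<gamma> s * (norm (x s - x t) / \<bar>s - t\<bar> + \<bar>\<gamma> s - \<gamma> t\<bar> / \<bar>s - t\<bar> * norm (a t)) + \<bar>\<delta> s - \<delta> t\<bar> / \<bar>s - t\<bar> * norm (a t)) \<longlongrightarrow>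
     \<delta> t / \<gamma> t * (norm (x' t) + \<bar>\<gamma>' t\<bar> * norm (a t)) + \<bar>\<delta>' t\<bar> * norm (a t)) (at t)"
    by (intro tendsto_intros has_vector_derivative_norm_quotient x_deriv t g isContD c) (use \<gamma>_pos[of t] t in auto)
  have "\<forall>\<^sub>F s in at t. s > t0"
    using t by (intro order_tendstoD(1)[OF tendsto_ident_at])
  then show "\<forall>\<^sub>F s in at t. norm (p s - p t) / \<bar>s - t\<bar> \<le> \<delta> s / \<gamma> s * (norm (x s - x t) / \<bar>s - t\<bar> + \<bar>\<gamma> s - \<gamma> t\<bar> / \<bar>s - t\<bar> * norm (a t)) + \<bar>\<delta> s - \<delta> t\<bar> / \<bar>s - t\<bar> * norm (a t)"
  proof (rule eventually_mono)
    fix s assume s: "t0 < s"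
    have ga: "norm (a s - a t) \<le> (norm (x s - x t) + \<bar>\<gamma> s - \<gamma> t\<bar> * norm (a t)) / \<gamma> s"
      using a_diff[of s t] \<gamma>_pos[of s] s t by (simp add: pos_le_divide_eq mult.commute abs_minus_commute)
    have "p s - p t = \<delta> s *\<^sub>R (a s - a t) + (\<delta> s - \<delta> t) *\<^sub>R a t"
      by (simp add: p_def algebra_simps)
    then have "norm (p s - p t) \<le> \<delta> s * norm (a s - a t) + \<bar>\<delta> s - \<delta> t\<bar> * norm (a t)"
      using norm_triangle_ineq[of "\<delta> s *\<^sub>R (a s - a t)" "(\<delta> s - \<delta> t) *\<^sub>R a t"] \<delta>_pos[of s] s by simp
    also have "\<dots> \<le> \<delta> s * ((norm (x s - x t) + \<bar>\<gamma> s - \<gamma> t\<bar> * norm (a t)) / \<gamma> s) + \<bar>\<delta> s - \<delta> t\<bar> * norm (a t)"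
      using ga \<delta>_pos[of s] s by (intro add_right_mono mult_left_mono) auto
    finally have "norm (p s - p t) / \<bar>s - t\<bar> \<le> (\<delta> s * ((norm (x s - x t) + \<bar>\<gamma> s - \<gamma> t\<bar> * norm (a t)) / \<gamma> s) + \<bar>\<delta> s - \<delta> t\<bar> * norm (a t)) / \<bar>s - t\<bar>"
      by (rule divide_right_mono) simp
    also have "\<dots> = \<delta> s / \<gamma> s * (norm (x s - x t) / \<bar>s - t\<bar> + \<bar>\<gamma> s - \<gamma> t\<bar> / \<bar>s - t\<bar> * norm (a t)) + \<bar>\<delta> s - \<delta> t\<bar> / \<bar>s - t\<bar> * norm (a t)"
      by (simp add: add_divide_distrib distrib_left mult.commute mult.left_commute)
    finally show "norm (p s - p t) / \<bar>s - t\<bar> \<le> \<delta> s / \<gamma> s * (norm (x s - x t) / \<bar>s - t\<bar> + \<bar>\<gamma> s - \<gamma> t\<bar> / \<bar>s - t\<bar> * norm (a t)) + \<bar>\<delta> s - \<delta> t\<bar> / \<bar>s - t\<bar> * norm (a t)" .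
  qed
qed simp

end

section \<open>Energy, dissipation and integrability\<close>

lemma quadratic_form_bound:
  fixes A B b X Y :: real
  assumes "A > 0" "b\<^sup>2 \<le> 4 * A * B"
  shows "b * X * Y \<le> A * X\<^sup>2 + B * Y\<^sup>2"
proof -
  have "0 \<le> (2 * A * X - b * Y)\<^sup>2 + (4 * A * B - b\<^sup>2) * Y\<^sup>2"
    using assms by simp
  also have "\<dots> = 4 * A * (A * X\<^sup>2 + B * Y\<^sup>2 - b * X * Y)"
    by (simp add: power2_eq_square algebra_simps)
  finally show ?thesis using assms(1) by (simp add: zero_le_mult_iff)
qed

context yosida_flow
begin

definition q :: "real \<Rightarrow> real" where "q t = t * (norm (x' t))\<^sup>2 + t ^ 3 * (norm (p t))\<^sup>2"

definition I :: "real \<Rightarrow> real" where "I t = integral {t0..t} q"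

lemma q_cont: "continuous_on {t0..} q"
  unfolding q_def by (intro continuous_intros x'_cont p_cont)

lemma q_ge:
  assumes "t0 \<le> t"
  shows "0 \<le> q t" "t * (norm (x' t))\<^sup>2 \<le> q t" "t ^ 3 * (norm (p t))\<^sup>2 \<le> q t"
    "2 * (t\<^sup>2 * (norm (x' t) * norm (p t))) \<le> q t"
proof -
  have t: "0 < t" using assms t0 by simp
  have nn: "0 \<le> t * (norm (x' t))\<^sup>2" "0 \<le> t ^ 3 * (norm (p t))\<^sup>2" using t by simp_all
  then show "0 \<le> q t" "t * (norm (x' t))\<^sup>2 \<le> q t" "t ^ 3 * (norm (p t))\<^sup>2 \<le> q t"
    by (simp_all add: q_def)
  have "0 \<le> t * (norm (x' t) - t * norm (p t))\<^sup>2" using t by simp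
  also have "\<dots> = q t - 2 * (t\<^sup>2 * (norm (x' t) * norm (p t)))"
    unfolding q_def by (simp add: power2_eq_square power3_eq_cube algebra_simps)
  finally show "2 * (t\<^sup>2 * (norm (x' t) * norm (p t))) \<le> q t" by simp
qed

lemma I_deriv:
  assumes "t0 < t"
  shows "(I has_real_derivative q t) (at t)"
proof -
  have "((\<lambda>s. integral {t0..s} q) has_real_derivative q t) (at t within {t0..t + 1})"
    using assms by (intro integral_has_real_derivative continuous_on_subset[OF q_cont]) auto
  moreover have "at t within {t0..t + 1} = at t"
    using assms by (intro at_within_interior) simp
  ultimately show ?thesis by (simp add: I_def[abs_def])
qed

lemma p_cocoercive:
  assumes "z \<in> zer A" "t0 \<le> t"
  shows "\<gamma> t * (norm (p t))\<^sup>2 \<le> \<delta> t * ((x t - z) \<bullet> p t)"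
proof -
  have "(\<delta> t)\<^sup>2 * (\<gamma> t * (norm (a t))\<^sup>2) \<le> (\<delta> t)\<^sup>2 * ((x t - z) \<bullet> a t)"
    unfolding a_def using assms by (intro mult_left_mono yosida_cocoercive[OF A] \<gamma>_pos) auto
  moreover have "\<gamma> t * (norm (p t))\<^sup>2 = (\<delta> t)\<^sup>2 * (\<gamma> t * (norm (a t))\<^sup>2)"
    by (simp add: p_def power_mult_distrib)
  moreover have "\<delta> t * ((x t - z) \<bullet> p t) = (\<delta> t)\<^sup>2 * ((x t - z) \<bullet> a t)"
    by (simp add: p_def power2_eq_square)
  ultimately show ?thesis by (simp only:)
qed

text \<open>The weight of the second square cancels the terms in
  \<open>(x - z) \<bullet> x'\<close>: the vector in the first square has derivative
  \<open>- (\<alpha> - \<sigma> - 1) x' - t p\<close>, so it contributes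
  \<open>- \<sigma> (\<alpha> - \<sigma> - 1) (x - z) \<bullet> x'\<close>.\<close>

definition energy :: "real \<Rightarrow> 'a \<Rightarrow> real \<Rightarrow> real" where
  "energy \<sigma> z t = (norm (\<sigma> *\<^sub>R (x t - z) + w t))\<^sup>2 / 2 + \<sigma> * (\<alpha> - \<sigma> - 1) * (norm (x t - z))\<^sup>2 / 2"

lemma energy_deriv:
  assumes t: "t0 < t"
  shows "(energy \<sigma> z has_real_derivative
    - (\<sigma> * t * ((x t - z) \<bullet> p t) + (\<alpha> - \<sigma> - 1) * t * (norm (x' t))\<^sup>2
       + (t\<^sup>2 + t * \<beta> * (\<alpha> - \<sigma> - 1)) * (x' t \<bullet> p t) + t\<^sup>2 * \<beta> * (norm (p t))\<^sup>2)) (at t)"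
proof -
  define v where "v t = \<sigma> *\<^sub>R (x t - z) + w t" for t
  define e where "e t = x t - z" for t
  have e: "(e has_vector_derivative x' t) (at t)"
    unfolding e_def by (rule derivative_eq_intros x_deriv[OF t] refl | simp)+
  have v: "(v has_vector_derivative (- (\<alpha> - \<sigma> - 1)) *\<^sub>R x' t - t *\<^sub>R p t) (at t)"
  proof -
    have "(v has_vector_derivative (\<sigma> *\<^sub>R (x' t - 0) + ((1 - \<alpha>) *\<^sub>R x' t - t *\<^sub>R p t))) (at t)"
      unfolding v_def
      by (intro has_vector_derivative_add has_vector_derivative_diff w_deriv[OF t] x_deriv[OF t] has_vector_derivative_const
          bounded_linear.has_vector_derivative[OF bounded_linear_scaleR_right])
    then show ?thesis by (simp add: algebra_simps)
  qed
  note inner_d = bounded_bilinear.has_vector_derivative[OF bounded_bilinear_inner]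
  have "((\<lambda>t. v t \<bullet> v t / 2 + \<sigma> * (\<alpha> - \<sigma> - 1) * (e t \<bullet> e t) / 2) has_real_derivative
     ((v t \<bullet> ((- (\<alpha> - \<sigma> - 1)) *\<^sub>R x' t - t *\<^sub>R p t) + ((- (\<alpha> - \<sigma> - 1)) *\<^sub>R x' t - t *\<^sub>R p t) \<bullet> v t) / 2
     + \<sigma> * (\<alpha> - \<sigma> - 1) * (e t \<bullet> x' t + x' t \<bullet> e t) / 2)) (at t)"
    by (intro DERIV_add DERIV_cdivide DERIV_cmult)
      (use inner_d[OF v v] inner_d[OF e e] in \<open>simp_all add: has_real_derivative_iff_has_vector_derivative\<close>)
  also have "(\<lambda>t. v t \<bullet> v t / 2 + \<sigma> * (\<alpha> - \<sigma> - 1) * (e t \<bullet> e t) / 2) = energy \<sigma> z"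
    by (auto simp: energy_def v_def e_def power2_norm_eq_inner)
  also have "(v t \<bullet> ((- (\<alpha> - \<sigma> - 1)) *\<^sub>R x' t - t *\<^sub>R p t) + ((- (\<alpha> - \<sigma> - 1)) *\<^sub>R x' t - t *\<^sub>R p t) \<bullet> v t) / 2
     + \<sigma> * (\<alpha> - \<sigma> - 1) * (e t \<bullet> x' t + x' t \<bullet> e t) / 2
     = v t \<bullet> ((- (\<alpha> - \<sigma> - 1)) *\<^sub>R x' t - t *\<^sub>R p t) + \<sigma> * (\<alpha> - \<sigma> - 1) * (e t \<bullet> x' t)"
    by (simp add: inner_commute)
  also have "v t = \<sigma> *\<^sub>R e t + t *\<^sub>R x' t + (t * \<beta>) *\<^sub>R p t"
    by (simp add: v_def e_def w_def)
  also have "(\<sigma> *\<^sub>R e t + t *\<^sub>R x' t + (t * \<beta>) *\<^sub>R p t) \<bullet> ((- (\<alpha> - \<sigma> - 1)) *\<^sub>R x' t - t *\<^sub>R p t) + \<sigma> * (\<alpha> - \<sigma> - 1) * (e t \<bullet> x' t)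
    = - (\<sigma> * t * (e t \<bullet> p t) + (\<alpha> - \<sigma> - 1) * t * (norm (x' t))\<^sup>2
       + (t\<^sup>2 + t * \<beta> * (\<alpha> - \<sigma> - 1)) * (x' t \<bullet> p t) + t\<^sup>2 * \<beta> * (norm (p t))\<^sup>2)"
    unfolding power2_norm_eq_inner inner_add_left inner_diff_right inner_scaleR_left inner_scaleR_right
      inner_commute[of "p t" "x' t"] power2_eq_square[of t]
    by (simp add: algebra_simps)
  finally show ?thesis by (simp add: e_def)
qed

end

text \<open>From \<open>T\<close> on the asymptotic hypotheses become plain inequalities.
  \<open>c\<close> will be taken below the limit of \<open>\<gamma> / (t\<^sup>2 \<delta>)\<close>,
  \<epsilon> is the margin in the discriminant, and \<open>M\<close>, \<open>G\<close> bound
  logarithmic derivatives. \<open>t0 < T\<close> makes derivatives two-sided, and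
  \<open>1 \<le> T\<close> lets higher powers of \<open>t\<close> absorb lower ones.\<close>

locale yosida_flow_tail = yosida_flow +
  fixes \<sigma> c \<epsilon> T M G :: real
  assumes \<beta>: "\<beta> > 0" and \<sigma>: "0 < \<sigma>" "\<sigma> < \<alpha> - 1" and c: "c > 0" and \<epsilon>: "0 < \<epsilon>" "\<epsilon> < \<alpha> - \<sigma> - 1"
    and T: "t0 < T" "1 \<le> T" and M: "M \<ge> 0" and G: "G \<ge> 0"
    and \<gamma>_ge: "\<And>t. T \<le> t \<Longrightarrow> c * (t\<^sup>2 * \<delta> t) \<le> \<gamma> t"
    and discriminant: "\<And>t. T \<le> t \<Longrightarrow> (1 + \<beta> * (\<alpha> - \<sigma> - 1) / t)\<^sup>2 \<le> 4 * (\<alpha> - \<sigma> - 1 - \<epsilon>) * (\<sigma> * c - \<epsilon>)"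
    and \<delta>'_nonneg: "\<And>t. T \<le> t \<Longrightarrow> 0 \<le> \<delta>' t" and \<delta>'_le: "\<And>t. T \<le> t \<Longrightarrow> \<delta>' t * t \<le> M * \<delta> t"
    and \<gamma>'_le: "\<And>t. T \<le> t \<Longrightarrow> \<bar>\<gamma>' t\<bar> * t \<le> G * \<gamma> t"
begin

lemma tail: "T \<le> t \<Longrightarrow> t0 < t" "T \<le> t \<Longrightarrow> t0 \<le> t" "T \<le> t \<Longrightarrow> 0 < t" "T \<le> t \<Longrightarrow> 1 \<le> t"
  using T t0 by auto

lemma dissipation:
  assumes z: "z \<in> zer A" and t: "T \<le> t"
  shows "\<epsilon> * q t \<le> \<sigma> * t * ((x t - z) \<bullet> p t) + (\<alpha> - \<sigma> - 1) * t * (norm (x' t))\<^sup>2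
       + (t\<^sup>2 + t * \<beta> * (\<alpha> - \<sigma> - 1)) * (x' t \<bullet> p t) + t\<^sup>2 * \<beta> * (norm (p t))\<^sup>2"
proof -
  define \<kappa> where "\<kappa> = \<alpha> - \<sigma> - 1"
  define X where "X = norm (x' t)"
  define P where "P = norm (p t)"
  \<comment> \<open>After cocoercivity, and up to the factor \<open>t\<close> and the nonnegative
    term \<open>t\<^sup>2 \<beta> P\<^sup>2\<close>, the right side is bounded below by a quadratic
    form in \<open>X\<close> and \<open>t * P\<close> with cross coefficient
    \<open>- b\<close>.\<close>
  define b where "b = 1 + \<beta> * \<kappa> / t"
  have t0: "0 < t" "t0 \<le> t" using tail[OF t] by auto
  have \<kappa>: "\<kappa> > 0" using \<sigma> by (simp add: \<kappa>_def)
  have "\<delta> t * (c * t\<^sup>2 * P\<^sup>2) \<le> \<gamma> t * P\<^sup>2"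
    using mult_right_mono[OF \<gamma>_ge[OF t], of "P\<^sup>2"] by (simp add: mult_ac)
  also have "\<dots> \<le> \<delta> t * ((x t - z) \<bullet> p t)"
    unfolding P_def by (rule p_cocoercive[OF z t0(2)])
  finally have co: "c * t\<^sup>2 * P\<^sup>2 \<le> (x t - z) \<bullet> p t"
    using \<delta>_pos[OF t0(2)] by simp
  have "b\<^sup>2 \<le> 4 * (\<kappa> - \<epsilon>) * (\<sigma> * c - \<epsilon>)"
    using discriminant[OF t] by (simp add: b_def \<kappa>_def)
  then have "b * X * (t * P) \<le> (\<kappa> - \<epsilon>) * X\<^sup>2 + (\<sigma> * c - \<epsilon>) * (t * P)\<^sup>2"
    using \<epsilon> by (intro quadratic_form_bound) (simp_all add: \<kappa>_def)
  then have "t * (b * X * (t * P)) \<le> t * ((\<kappa> - \<epsilon>) * X\<^sup>2 + (\<sigma> * c - \<epsilon>) * (t * P)\<^sup>2)"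
    using t0(1) by (intro mult_left_mono) auto
  also have "t * (b * X * (t * P)) = (t\<^sup>2 + t * \<beta> * \<kappa>) * (X * P)"
    using t0(1) by (simp add: b_def power2_eq_square algebra_simps)
  also have "t * ((\<kappa> - \<epsilon>) * X\<^sup>2 + (\<sigma> * c - \<epsilon>) * (t * P)\<^sup>2) = \<sigma> * t * (c * t\<^sup>2 * P\<^sup>2) + \<kappa> * t * X\<^sup>2 - \<epsilon> * q t"
    unfolding q_def X_def[symmetric] P_def[symmetric]
    by (simp add: power2_eq_square power3_eq_cube algebra_simps)
  finally have 1: "(t\<^sup>2 + t * \<beta> * \<kappa>) * (X * P) \<le> \<sigma> * t * (c * t\<^sup>2 * P\<^sup>2) + \<kappa> * t * X\<^sup>2 - \<epsilon> * q t" .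
  have "- (X * P) \<le> x' t \<bullet> p t"
    using Cauchy_Schwarz_ineq2[of "x' t" "p t"] by (simp add: X_def P_def abs_le_iff)
  then have 2: "(t\<^sup>2 + t * \<beta> * \<kappa>) * (- (X * P)) \<le> (t\<^sup>2 + t * \<beta> * \<kappa>) * (x' t \<bullet> p t)"
    using t0(1) \<beta> \<kappa> by (intro mult_left_mono) auto
  have 3: "\<sigma> * t * (c * t\<^sup>2 * P\<^sup>2) \<le> \<sigma> * t * ((x t - z) \<bullet> p t)"
    using co \<sigma>(1) t0(1) by (intro mult_left_mono) auto
  have 4: "0 \<le> t\<^sup>2 * \<beta> * P\<^sup>2" using \<beta> by simp
  from 1 2 3 4 show ?thesis
    unfolding \<kappa>_def[symmetric] X_def[symmetric] P_def[symmetric] by linarith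
qed

lemma energy_nonneg: "0 \<le> energy \<sigma> z t"
  and energy_ge: "\<sigma> * (\<alpha> - \<sigma> - 1) * (norm (x t - z))\<^sup>2 / 2 \<le> energy \<sigma> z t"
  using \<sigma> by (auto simp: energy_def intro!: add_nonneg_nonneg)

lemma I_mono: "T \<le> s \<Longrightarrow> s \<le> t \<Longrightarrow> I s \<le> I t"
  by (rule deriv_nonneg_mono_from[OF I_deriv q_ge(1)]) (auto intro: tail)

lemma energy_decrease:
  assumes z: "z \<in> zer A" and st: "T \<le> s" "s \<le> t"
  shows "energy \<sigma> z t + \<epsilon> * I t \<le> energy \<sigma> z s + \<epsilon> * I s"
proof -
  have "- energy \<sigma> z s - \<epsilon> * I s \<le> - energy \<sigma> z t - \<epsilon> * I t"
  proof (rule deriv_nonneg_mono_from[OF _ _ st])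
    show "((\<lambda>t. - energy \<sigma> z t - \<epsilon> * I t) has_real_derivative
      - (- (\<sigma> * t * ((x t - z) \<bullet> p t) + (\<alpha> - \<sigma> - 1) * t * (norm (x' t))\<^sup>2
       + (t\<^sup>2 + t * \<beta> * (\<alpha> - \<sigma> - 1)) * (x' t \<bullet> p t) + t\<^sup>2 * \<beta> * (norm (p t))\<^sup>2)) - \<epsilon> * q t) (at t)"
      if "T \<le> t" for t
      by (intro DERIV_diff DERIV_minus DERIV_cmult energy_deriv I_deriv tail that)
  next
    fix t assume "T \<le> t"
    from dissipation[OF z this] show "0 \<le> - (- (\<sigma> * t * ((x t - z) \<bullet> p t) + (\<alpha> - \<sigma> - 1) * t * (norm (x' t))\<^sup>2
       + (t\<^sup>2 + t * \<beta> * (\<alpha> - \<sigma> - 1)) * (x' t \<bullet> p t) + t\<^sup>2 * \<beta> * (norm (p t))\<^sup>2)) - \<epsilon> * q t"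
      by linarith
  qed
  then show ?thesis by linarith
qed

lemma energy_antimono:
  assumes "z \<in> zer A" "T \<le> s" "s \<le> t"
  shows "energy \<sigma> z t \<le> energy \<sigma> z s"
  using energy_decrease[OF assms] mult_left_mono[OF I_mono[OF assms(2,3)], of \<epsilon>] \<epsilon>(1) by linarith

lemma energy_converges:
  assumes "z \<in> zer A"
  shows "\<exists>l. (energy \<sigma> z \<longlongrightarrow> l) at_top"
  using energy_antimono[OF assms] energy_nonneg by (rule decreasing_bounded_below_convergent_at_top)

lemma I_bounded:
  assumes "zer A \<noteq> {}"
  obtains B where "\<And>t. T \<le> t \<Longrightarrow> I t \<le> B"
proof -
  obtain z where z: "z \<in> zer A" using assms by blast
  have "I t \<le> (energy \<sigma> z T + \<epsilon> * I T) / \<epsilon>" if "T \<le> t" for t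
    using energy_decrease[OF z order_refl that] energy_nonneg[of z t] \<epsilon>(1)
    by (simp add: pos_le_divide_eq mult.commute)
  then show thesis by (rule that)
qed

lemma x_bounded:
  assumes "z \<in> zer A"
  obtains B where "\<And>t. T \<le> t \<Longrightarrow> norm (x t - z) \<le> B"
proof -
  define k where "k = \<sigma> * (\<alpha> - \<sigma> - 1) / 2"
  have k: "k > 0" using \<sigma> by (simp add: k_def)
  have "norm (x t - z) \<le> sqrt (energy \<sigma> z T / k)" if "T \<le> t" for t
  proof (rule real_le_rsqrt)
    have "k * (norm (x t - z))\<^sup>2 \<le> energy \<sigma> z T"
      using energy_ge[of t z] energy_antimono[OF assms order_refl that] by (simp add: k_def)
    then show "(norm (x t - z))\<^sup>2 \<le> energy \<sigma> z T / k"
      using k by (simp add: pos_le_divide_eq mult.commute)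
  qed
  then show thesis by (rule that)
qed

section \<open>Decay rates of \<open>p\<close> and \<open>w\<close>\<close>

lemma p_deriv_tail:
  assumes t: "T \<le> t" and D: "(p has_vector_derivative D) (at t)"
  shows "t ^ 4 * (2 * (p t \<bullet> D)) \<le> (1 / c + 2 * (G + M)) * q t"
proof -
  note tt = tail[OF t]
  define X where "X = norm (x' t)"
  define P where "P = norm (p t)"
  have pos: "\<delta> t > 0" "\<gamma> t > 0" using \<delta>_pos \<gamma>_pos tt by auto
  have nn: "0 \<le> X" "0 \<le> P" by (auto simp: X_def P_def)
  have a: "\<delta> t * norm (a t) = P" using pos by (simp add: P_def p_def)
  have "norm D \<le> \<delta> t / \<gamma> t * (X + \<bar>\<gamma>' t\<bar> * norm (a t)) + \<bar>\<delta>' t\<bar> * norm (a t)"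
    using p_deriv_bound[OF tt(1) D] by (simp add: X_def)
  also have "\<dots> = \<delta> t / \<gamma> t * X + \<bar>\<gamma>' t\<bar> / \<gamma> t * P + \<bar>\<delta>' t\<bar> / \<delta> t * P"
    using pos by (simp add: a[symmetric] field_simps)
  \<comment> \<open>The lower bound on \<gamma> handles the \<open>x'\<close> term, and the
    logarithmic derivatives are at most \<open>G / t\<close> and \<open>M / t\<close>. Multiplied by
    \<open>t ^ 4 * P\<close>, each summand becomes a quantity that \<open>q\<close>
    dominates.\<close>
  also have "\<dots> \<le> 1 / (c * t\<^sup>2) * X + G / t * P + M / t * P"
  proof (intro add_mono mult_right_mono nn)
    show "\<delta> t / \<gamma> t \<le> 1 / (c * t\<^sup>2)"
      using \<gamma>_ge[OF t] pos c tt by (simp add: divide_simps mult_ac)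
    show "\<bar>\<gamma>' t\<bar> / \<gamma> t \<le> G / t" using \<gamma>'_le[OF t] pos tt by (simp add: divide_simps mult_ac)
    show "\<bar>\<delta>' t\<bar> / \<delta> t \<le> M / t" using \<delta>'_le[OF t] \<delta>'_nonneg[OF t] pos tt by (simp add: divide_simps mult_ac)
  qed
  finally have D_le: "norm D \<le> 1 / (c * t\<^sup>2) * X + G / t * P + M / t * P" .
  have "p t \<bullet> D \<le> P * norm D" unfolding P_def by (rule norm_cauchy_schwarz)
  also have "\<dots> \<le> P * (1 / (c * t\<^sup>2) * X + G / t * P + M / t * P)"
    using D_le nn by (intro mult_left_mono)
  finally have "t ^ 4 * (2 * (p t \<bullet> D)) \<le> t ^ 4 * (2 * (P * (1 / (c * t\<^sup>2) * X + G / t * P + M / t * P)))"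
    by (intro mult_left_mono) auto
  also have "\<dots> = 1 / c * (2 * (t\<^sup>2 * (X * P))) + 2 * (G + M) * (t ^ 3 * P\<^sup>2)"
    using tt(3) c by (simp add: field_simps power2_eq_square power3_eq_cube power4_eq_xxxx)
  also have "\<dots> \<le> 1 / c * q t + 2 * (G + M) * q t"
    using q_ge(3,4)[OF tt(2)] c G M unfolding X_def P_def by (intro add_mono mult_left_mono) auto
  finally show ?thesis by (simp add: algebra_simps)
qed

lemma p_rate:
  assumes "zer A \<noteq> {}"
  shows "((\<lambda>t. t ^ 4 * (norm (p t))\<^sup>2) \<longlongrightarrow> 0) at_top"
proof -
  obtain B where B: "\<And>t. T \<le> t \<Longrightarrow> I t \<le> B" using I_bounded[OF assms] by blast
  \<comment> \<open>The \<open>4\<close> pays for differentiating \<open>t ^ 4\<close>; the rest is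
    the constant of \<open>p_deriv_tail\<close>.\<close>
  define C where "C = 4 + (1 / c + 2 * (G + M))"
  show ?thesis
  proof (rule tendsto_zero_of_integrable_rate[where T = T and I = I and q = q and C = C and K = 1 and B = B])
    show "C \<ge> 0" using c G M by (simp add: C_def)
    show "t ^ 4 * (norm (p t))\<^sup>2 \<le> 1 * (t * q t)" if "T \<le> t" for t
    proof -
      have "t ^ 4 * (norm (p t))\<^sup>2 = t * (t ^ 3 * (norm (p t))\<^sup>2)"
        by (simp add: power_eq_if)
      also have "\<dots> \<le> t * q t" using q_ge(3) tail[OF that] by (intro mult_left_mono) auto
      finally show ?thesis by simp
    qed
    fix s t assume st: "T \<le> s" "s \<le> t"
    obtain N where N: "negligible N" and ode: "\<And>t. t0 < t \<Longrightarrow> t \<notin> N \<Longrightarrow> \<exists>D. (p has_vector_derivative D) (at t)"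
      using ode_outside_negligible by blast
    have sub: "{s..t} \<subseteq> {t0..}" "{s..t} \<subseteq> {T..}" using st T by auto
    have "t ^ 4 * (p t \<bullet> p t) - C * I t \<le> s ^ 4 * (p s \<bullet> p s) - C * I s"
    proof (rule absolutely_continuous_deriv_nonpos_decreasing[OF _ st(2) N])
      have "absolutely_continuous_fun s t (\<lambda>r. r ^ 4 * (p r \<bullet> p r))"
      proof (rule bounded_bilinear_absolutely_continuous_fun[OF bounded_bilinear_mult])
        show "absolutely_continuous_fun s t (\<lambda>r. r ^ 4)"
          by (rule absolutely_continuous_fun_C1[where f' = "\<lambda>r. 4 * r ^ 3"])
            (auto intro!: derivative_eq_intros continuous_intros simp flip: has_real_derivative_iff_has_vector_derivative)
        show "absolutely_continuous_fun s t (\<lambda>r. p r \<bullet> p r)"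
          using st T by (intro bounded_bilinear_absolutely_continuous_fun[OF bounded_bilinear_inner] p_ac
              continuous_on_subset[OF p_cont sub(1)]) auto
      qed (intro continuous_intros continuous_on_subset[OF p_cont sub(1)])+
      moreover have "absolutely_continuous_fun s t (\<lambda>r. - (C * I r))"
      proof (rule absolutely_continuous_fun_C1)
        show "((\<lambda>r. - (C * I r)) has_vector_derivative - (C * q r)) (at r within {s..t})" if "r \<in> {s..t}" for r
          unfolding has_real_derivative_iff_has_vector_derivative[symmetric]
          by (intro DERIV_minus DERIV_cmult has_field_derivative_at_within[OF I_deriv] tail) (use that st in auto)
        show "continuous_on {s..t} (\<lambda>r. - (C * q r))"
          by (intro continuous_intros continuous_on_subset[OF q_cont sub(1)])
      qed
      ultimately have "absolutely_continuous_fun s t (\<lambda>r. r ^ 4 * (p r \<bullet> p r) + - (C * I r))"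
        by (rule absolutely_continuous_fun_add)
      then show "absolutely_continuous_fun s t (\<lambda>r. r ^ 4 * (p r \<bullet> p r) - C * I r)" by simp
    next
      fix r assume "r \<in> {s..t} - N"
      then have r: "T \<le> r" "r \<notin> N" using st by auto
      obtain D where D: "(p has_vector_derivative D) (at r)" using ode[OF tail(1)[OF r(1)] r(2)] by blast
      have "((\<lambda>r. p r \<bullet> p r) has_real_derivative (p r \<bullet> D + D \<bullet> p r)) (at r)"
        unfolding has_real_derivative_iff_has_vector_derivative
        by (rule bounded_bilinear.has_vector_derivative[OF bounded_bilinear_inner D D])
      then have "((\<lambda>r. r ^ 4 * (p r \<bullet> p r) - C * I r) has_real_derivative
          (4 * r ^ 3 * (p r \<bullet> p r) + r ^ 4 * (2 * (p r \<bullet> D)) - C * q r)) (at r)"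
        using I_deriv[OF tail(1)[OF r(1)]]
        by (auto intro!: derivative_eq_intros simp: inner_commute)
      moreover have "4 * r ^ 3 * (p r \<bullet> p r) \<le> 4 * q r"
        using q_ge(3)[of r] tail(2)[OF r(1)] by (simp add: power2_norm_eq_inner)
      then have "4 * r ^ 3 * (p r \<bullet> p r) + r ^ 4 * (2 * (p r \<bullet> D)) - C * q r \<le> 0"
        using p_deriv_tail[OF r(1) D] unfolding C_def distrib_right[of 4] by linarith
      ultimately show "\<exists>D\<le>0. ((\<lambda>r. r ^ 4 * (p r \<bullet> p r) - C * I r) has_real_derivative D) (at r within {s..t})"
        by (blast intro: has_field_derivative_at_within)
    qed
    then show "t ^ 4 * (norm (p t))\<^sup>2 - C * I t \<le> s ^ 4 * (norm (p s))\<^sup>2 - C * I s"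
      by (simp add: power2_norm_eq_inner)
  qed (use T t0 I_deriv q_ge(1) B tail in auto)
qed

lemma w_rate:
  assumes "zer A \<noteq> {}"
  shows "((\<lambda>t. (norm (w t))\<^sup>2) \<longlongrightarrow> 0) at_top"
proof -
  obtain B where B: "\<And>t. T \<le> t \<Longrightarrow> I t \<le> B" using I_bounded[OF assms] by blast
  define k where "k = \<bar>1 - \<alpha>\<bar>"
  \<comment> \<open>The four summands match the four products in the expansion of
    \<open>2 * (r * X + r * \<beta> * P) * (k * X + r * P)\<close>, each bounded by a multiple of
    \<open>q r\<close>.\<close>
  define C where "C = 2 * k + 1 + k * \<beta> + 2 * \<beta>"
  have k: "k \<ge> 0" by (simp add: k_def)
  have bound: "norm (w t) \<le> t * norm (x' t) + t * \<beta> * norm (p t)" if "T \<le> t" for t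
    using norm_triangle_ineq[of "t *\<^sub>R x' t" "(t * \<beta>) *\<^sub>R p t"] tail[OF that] \<beta> by (simp add: w_def abs_mult)
  show ?thesis
  proof (rule tendsto_zero_of_integrable_rate[where T = T and I = I and q = q and C = C and K = "2 + 2 * \<beta>\<^sup>2" and B = B])
    show "C \<ge> 0" using k \<beta> by (simp add: C_def)
    show "2 + 2 * \<beta>\<^sup>2 > 0" using zero_le_power2[of \<beta>] by linarith
    show "(norm (w t))\<^sup>2 \<le> (2 + 2 * \<beta>\<^sup>2) * (t * q t)" if t: "T \<le> t" for t
    proof -
      note tt = tail[OF t]
      have "(norm (w t))\<^sup>2 \<le> (t * norm (x' t) + t * \<beta> * norm (p t))\<^sup>2"
        using bound[OF t] by (intro power_mono) auto
      \<comment> \<open>A squared sum is at most twice the sum of the squares; this is the origin of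
        \<open>K = 2 + 2 * \<beta>\<^sup>2\<close>.\<close>
      also have "\<dots> \<le> 2 * (t * (t * (norm (x' t))\<^sup>2)) + 2 * \<beta>\<^sup>2 * (t\<^sup>2 * (norm (p t))\<^sup>2)"
        using zero_le_power2[of "t * norm (x' t) - t * \<beta> * norm (p t)"]
        by (simp add: power2_eq_square algebra_simps)
      also have "\<dots> \<le> 2 * (t * q t) + 2 * \<beta>\<^sup>2 * (t * q t)"
      proof (intro add_mono mult_left_mono)
        have "t\<^sup>2 * (norm (p t))\<^sup>2 \<le> t ^ 4 * (norm (p t))\<^sup>2"
          using tt(4) by (intro mult_right_mono power_increasing) auto
        also have "\<dots> = t * (t ^ 3 * (norm (p t))\<^sup>2)" by (simp add: power_eq_if)
        also have "\<dots> \<le> t * q t" using q_ge(3) tt by (intro mult_left_mono) auto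
        finally show "t\<^sup>2 * (norm (p t))\<^sup>2 \<le> t * q t" .
      qed (use q_ge(2) tt in auto)
      finally show ?thesis by (simp add: distrib_right)
    qed
    fix s t assume st: "T \<le> s" "s \<le> t"
    have "C * I s - w s \<bullet> w s \<le> C * I t - w t \<bullet> w t"
    proof (rule deriv_nonneg_mono_from[OF _ _ st])
      fix r assume r: "T \<le> r"
      note rr = tail[OF r]
      define w' where "w' = (1 - \<alpha>) *\<^sub>R x' r - r *\<^sub>R p r"
      have "(w has_vector_derivative w') (at r)" unfolding w'_def by (rule w_deriv[OF rr(1)])
      from bounded_bilinear.has_vector_derivative[OF bounded_bilinear_inner this this]
      have "((\<lambda>r. w r \<bullet> w r) has_real_derivative (w r \<bullet> w' + w' \<bullet> w r)) (at r)"
        unfolding has_real_derivative_iff_has_vector_derivative .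
      then show "((\<lambda>r. C * I r - w r \<bullet> w r) has_real_derivative (C * q r - (w r \<bullet> ((1 - \<alpha>) *\<^sub>R x' r - r *\<^sub>R p r) + ((1 - \<alpha>) *\<^sub>R x' r - r *\<^sub>R p r) \<bullet> w r))) (at r)"
        unfolding w'_def by (intro DERIV_diff DERIV_cmult I_deriv rr)
      define X where "X = norm (x' r)"
      define P where "P = norm (p r)"
      have nn: "0 \<le> X" "0 \<le> P" "0 \<le> X * P" by (auto simp: X_def P_def)
      have "norm w' \<le> k * X + r * P"
        using norm_triangle_ineq4[of "(1 - \<alpha>) *\<^sub>R x' r" "r *\<^sub>R p r"] rr by (simp add: w'_def k_def X_def P_def)
      then have "w r \<bullet> w' \<le> (r * X + r * \<beta> * P) * (k * X + r * P)"
        using bound[OF r] by (intro order_trans[OF norm_cauchy_schwarz] mult_mono)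
          (use nn rr \<beta> in \<open>auto simp: X_def P_def\<close>)
      then have "2 * (w r \<bullet> w') \<le> 2 * k * (r * X\<^sup>2) + 2 * (r\<^sup>2 * (X * P)) + k * \<beta> * (2 * (r * (X * P))) + 2 * \<beta> * (r\<^sup>2 * P\<^sup>2)"
        by (simp add: power2_eq_square algebra_simps)
      also have "\<dots> \<le> 2 * k * q r + q r + k * \<beta> * q r + 2 * \<beta> * q r"
      proof (intro add_mono mult_left_mono)
        show "r * X\<^sup>2 \<le> q r" "2 * (r\<^sup>2 * (X * P)) \<le> q r" using q_ge rr by (auto simp: X_def P_def)
        have "r * (X * P) \<le> r\<^sup>2 * (X * P)"
          using rr(4) nn power_increasing[of 1 2 r] by (intro mult_right_mono) auto
        then show "2 * (r * (X * P)) \<le> q r" using \<open>2 * (r\<^sup>2 * (X * P)) \<le> q r\<close> by linarith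
        have "r\<^sup>2 * P\<^sup>2 \<le> r ^ 3 * P\<^sup>2"
          using rr(4) by (intro mult_right_mono power_increasing) auto
        then show "r\<^sup>2 * P\<^sup>2 \<le> q r" using q_ge(3)[OF rr(2)] by (simp add: P_def)
      qed (use k \<beta> in auto)
      finally have "2 * (w r \<bullet> w') \<le> C * q r" by (simp add: C_def distrib_right)
      then show "0 \<le> C * q r - (w r \<bullet> ((1 - \<alpha>) *\<^sub>R x' r - r *\<^sub>R p r) + ((1 - \<alpha>) *\<^sub>R x' r - r *\<^sub>R p r) \<bullet> w r)"
        unfolding w'_def[symmetric] by (simp add: inner_commute)
    qed
    then show "(norm (w t))\<^sup>2 - C * I t \<le> (norm (w s))\<^sup>2 - C * I s"
      by (simp add: power2_norm_eq_inner)
  qed (use T t0 I_deriv q_ge(1) B tail in auto)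
qed

end

section \<open>From the decay rates to integrability, little-o rates and weak convergence\<close>

lemma resolvent_nonexpansive:
  fixes A :: "'a::{real_inner,complete_space} \<Rightarrow> 'a set"
  assumes "maximally_monotone A" "lam > 0"
  shows "norm ((u - lam *\<^sub>R yosida A lam u) - (v - lam *\<^sub>R yosida A lam v)) \<le> norm (u - v)"
proof -
  define a b where "a = yosida A lam u" and "b = yosida A lam v"
  define y where "y = (u - lam *\<^sub>R a) - (v - lam *\<^sub>R b)"
  have "0 \<le> lam * (y \<bullet> (a - b))"
    unfolding y_def a_def b_def using assms yosida_mem[OF assms]
    by (intro mult_nonneg_nonneg monotone_operatorD[of A]) (auto simp: maximally_monotone_def)
  also have "\<dots> = y \<bullet> (u - v - y)"
    by (simp add: y_def inner_diff_right algebra_simps)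
  finally have "norm y * norm y \<le> y \<bullet> (u - v)"
    by (simp add: inner_diff_right dot_square_norm power2_eq_square)
  also have "\<dots> \<le> norm y * norm (u - v)" by (rule norm_cauchy_schwarz)
  finally have "norm y \<le> norm (u - v)" by (cases "y = 0") auto
  then show ?thesis by (simp add: y_def a_def b_def)
qed

lemma tendsto_zero_of_power2:
  fixes f :: "'b \<Rightarrow> real"
  assumes "((\<lambda>t. (f t)\<^sup>2) \<longlongrightarrow> 0) F"
  shows "(f \<longlongrightarrow> 0) F"
  using tendsto_real_sqrt[OF assms] by (simp add: tendsto_rabs_zero_iff)

lemma set_integrable_nonneg_bound:
  fixes q r :: "real \<Rightarrow> real"
  assumes q: "set_integrable lborel {t0..} q" and r: "continuous_on {t0..} r"
    and le: "\<And>t. t0 \<le> t \<Longrightarrow> 0 \<le> r t \<and> r t \<le> q t"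
  shows "set_integrable lborel {t0..} r"
  unfolding set_integrable_def
proof (rule Bochner_Integration.integrable_bound[OF q[unfolded set_integrable_def]])
  show "(\<lambda>t. indicator {t0..} t *\<^sub>R r t) \<in> borel_measurable lborel"
    using borel_measurable_continuous_on_indicator[OF _ r] by simp
  show "AE t in lborel. norm (indicator {t0..} t *\<^sub>R r t) \<le> norm (indicator {t0..} t *\<^sub>R q t)"
    using le by (intro AE_I2) (force simp: indicator_def)
qed

context yosida_flow_tail
begin

lemma q_integrable:
  assumes "zer A \<noteq> {}"
  shows "set_integrable lborel {t0..} q"
proof -
  obtain B where B: "\<And>t. T \<le> t \<Longrightarrow> I t \<le> B" using I_bounded[OF assms] by blast
  show ?thesis
    using q_cont q_ge(1) by (rule set_integrable_atLeast_nonneg[where T = T and I = I and B = B])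
      (use T I_deriv B tail in auto)
qed

lemma p_little_o:
  assumes "zer A \<noteq> {}"
  shows "((\<lambda>t. t\<^sup>2 * norm (p t)) \<longlongrightarrow> 0) at_top"
  by (rule tendsto_zero_of_power2) (use p_rate[OF assms] in \<open>simp add: power_mult_distrib flip: power_mult\<close>)

lemma w_little_o:
  assumes "zer A \<noteq> {}"
  shows "(w \<longlongrightarrow> 0) at_top"
  using tendsto_zero_of_power2[OF w_rate[OF assms]] by (simp add: tendsto_norm_zero_iff)

lemma p_tendsto:
  assumes "zer A \<noteq> {}"
  shows "((\<lambda>t. t * norm (p t)) \<longlongrightarrow> 0) at_top" "((\<lambda>t. norm (p t)) \<longlongrightarrow> 0) at_top"
proof -
  have ge: "t * norm (p t) \<le> t\<^sup>2 * norm (p t)" "norm (p t) \<le> t\<^sup>2 * norm (p t)" if "1 \<le> t" for t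
    using mult_right_mono[OF power_increasing[of 1 2 t] norm_ge_zero[of "p t"]]
      mult_right_mono[OF one_le_power[of t 2] norm_ge_zero[of "p t"]] that by auto
  show "((\<lambda>t. t * norm (p t)) \<longlongrightarrow> 0) at_top"
    by (rule Lim_null_comparison[OF _ p_little_o[OF assms]])
      (use ge(1) in \<open>auto intro!: eventually_mono[OF eventually_ge_at_top[of 1]]\<close>)
  show "((\<lambda>t. norm (p t)) \<longlongrightarrow> 0) at_top"
    by (rule Lim_null_comparison[OF _ p_little_o[OF assms]])
      (use ge(2) in \<open>auto intro!: eventually_mono[OF eventually_ge_at_top[of 1]]\<close>)
qed

lemma x'_little_o:
  assumes "zer A \<noteq> {}"
  shows "((\<lambda>t. t * norm (x' t)) \<longlongrightarrow> 0) at_top"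
proof -
  have "((\<lambda>t. norm (w t) + \<beta> * (t * norm (p t))) \<longlongrightarrow> norm (0 :: 'a) + \<beta> * 0) at_top"
    by (intro tendsto_intros w_little_o p_tendsto assms)
  then have lim: "((\<lambda>t. norm (w t) + \<beta> * (t * norm (p t))) \<longlongrightarrow> 0) at_top" by simp
  show ?thesis
  proof (rule Lim_null_comparison[OF _ lim], rule eventually_mono[OF eventually_ge_at_top[of T]])
    fix t assume "T \<le> t"
    note tt = tail[OF this]
    have "t *\<^sub>R x' t = w t - (t * \<beta>) *\<^sub>R p t" by (simp add: w_def)
    then have "norm (t *\<^sub>R x' t) \<le> norm (w t) + norm ((t * \<beta>) *\<^sub>R p t)"
      by (metis norm_triangle_ineq4)
    then show "norm (t * norm (x' t)) \<le> norm (w t) + \<beta> * (t * norm (p t))"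
      using tt \<beta> by (simp add: abs_mult mult_ac)
  qed
qed

text \<open>Twice the energy is \<open>\<sigma> (\<alpha> - 1) |x - z|\<^sup>2 + 2 \<sigma> (x - z)
  \<bullet> w + |w|\<^sup>2\<close>. The last two terms vanish in the limit because \<open>x\<close>
  is bounded and \<open>w\<close> tends to \<open>0\<close>, so the convergent energy determines the
  distance.\<close>

lemma norm_diff_converges:
  assumes z: "z \<in> zer A"
  shows "\<exists>l. ((\<lambda>t. norm (x t - z)) \<longlongrightarrow> l) at_top"
proof -
  have ne: "zer A \<noteq> {}" using z by blast
  obtain l where l: "(energy \<sigma> z \<longlongrightarrow> l) at_top" using energy_converges[OF z] by blast
  obtain B where B: "\<And>t. T \<le> t \<Longrightarrow> norm (x t - z) \<le> B" using x_bounded[OF z] by blast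
  have w: "(w \<longlongrightarrow> 0) at_top" by (rule w_little_o[OF ne])
  have "((\<lambda>t. B * norm (w t)) \<longlongrightarrow> B * norm (0 :: 'a)) at_top" by (intro tendsto_intros w)
  then have Bw: "((\<lambda>t. B * norm (w t)) \<longlongrightarrow> 0) at_top" by simp
  have "((\<lambda>t. (x t - z) \<bullet> w t) \<longlongrightarrow> 0) at_top"
  proof (rule Lim_null_comparison[OF _ Bw], rule eventually_mono[OF eventually_ge_at_top[of T]])
    fix t assume "T \<le> t"
    then show "norm ((x t - z) \<bullet> w t) \<le> B * norm (w t)"
      using Cauchy_Schwarz_ineq2[of "x t - z" "w t"] mult_right_mono[OF B, of t "norm (w t)"] by simp
  qed
  then have "((\<lambda>t. (2 * energy \<sigma> z t - (2 * \<sigma> * ((x t - z) \<bullet> w t) + (norm (w t))\<^sup>2)) / (\<sigma> * (\<alpha> - 1))) \<longlongrightarrow>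
      (2 * l - (2 * \<sigma> * 0 + (norm (0 :: 'a))\<^sup>2)) / (\<sigma> * (\<alpha> - 1))) at_top"
    using \<sigma> by (intro tendsto_intros l w) auto
  moreover have "(2 * energy \<sigma> z t - (2 * \<sigma> * ((x t - z) \<bullet> w t) + (norm (w t))\<^sup>2)) / (\<sigma> * (\<alpha> - 1)) = (norm (x t - z))\<^sup>2" for t
  proof -
    define e where "e = x t - z"
    have "2 * energy \<sigma> z t = \<sigma> * (\<alpha> - 1) * (norm e)\<^sup>2 + (2 * \<sigma> * (e \<bullet> w t) + (norm (w t))\<^sup>2)"
      unfolding energy_def e_def[symmetric] power2_norm_eq_inner
      by (simp add: inner_add_left inner_add_right inner_commute field_simps)
    then show ?thesis using \<sigma> by (simp add: e_def)
  qed
  ultimately have "((\<lambda>t. (norm (x t - z))\<^sup>2) \<longlongrightarrow> (2 * l - (2 * \<sigma> * 0 + (norm (0 :: 'a))\<^sup>2)) / (\<sigma> * (\<alpha> - 1))) at_top"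
    by simp
  from tendsto_real_sqrt[OF this] show ?thesis by auto
qed

lemma \<delta>_ge:
  assumes "T \<le> t"
  shows "\<delta> T \<le> \<delta> t"
proof (rule deriv_nonneg_mono_from[OF _ _ order_refl assms])
  show "(\<delta> has_real_derivative \<delta>' s) (at s)" if "T \<le> s" for s
    using C1_fromD(1)[OF \<delta> tail(1)[OF that]] by (simp add: has_real_derivative_iff_has_vector_derivative)
qed (rule \<delta>'_nonneg)

text \<open>Opial's argument needs one fixed nonexpansive map, whereas the index
  \<open>\<gamma> t\<close> tends to infinity. The residual is transferred to index \<open>1\<close>
  at the cost of a term \<open>\<gamma> |a|\<close>, the product of
  \<open>\<gamma> / (t\<^sup>2 \<delta>)\<close>, which has a finite limit, and
  \<open>t\<^sup>2 |p|\<close>, which vanishes.\<close>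

lemma converges_weakly_to_zero:
  assumes ne: "zer A \<noteq> {}" and L: "((\<lambda>t. \<gamma> t / (t\<^sup>2 * \<delta> t)) \<longlongrightarrow> L) at_top"
  shows "\<exists>z\<in>zer A. converges_weakly x z"
proof -
  define J where "J u = u - yosida A 1 u" for u
  have fix_J: "J z = z \<longleftrightarrow> z \<in> zer A" for z
    using zer_iff_yosida_eq_0[OF A, of 1 z] by (simp add: J_def)
  obtain z where z: "z \<in> zer A" using ne by blast
  obtain B where B: "\<And>t. T \<le> t \<Longrightarrow> norm (x t - z) \<le> B" using x_bounded[OF z] by blast
  have "((\<lambda>t. 2 * (norm (p t) / \<delta> T) + \<gamma> t / (t\<^sup>2 * \<delta> t) * (t\<^sup>2 * norm (p t))) \<longlongrightarrow> 2 * (0 / \<delta> T) + L * 0) at_top"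
    using \<delta>_pos[of T] T by (intro tendsto_intros p_tendsto(2) p_little_o ne L) auto
  then have lim: "((\<lambda>t. 2 * (norm (p t) / \<delta> T) + \<gamma> t / (t\<^sup>2 * \<delta> t) * (t\<^sup>2 * norm (p t))) \<longlongrightarrow> 0) at_top" by simp
  have "((\<lambda>t. x t - J (x t)) \<longlongrightarrow> 0) at_top"
  proof (rule Lim_null_comparison[OF _ lim], rule eventually_mono[OF eventually_ge_at_top[of T]])
    fix t assume t: "T \<le> t"
    note tt = tail[OF t]
    have pos: "\<delta> t > 0" "\<gamma> t > 0" "\<delta> T > 0" using \<delta>_pos \<gamma>_pos tt T by auto
    have p: "norm (p t) = \<delta> t * norm (a t)" using pos by (simp add: p_def)
    have "norm (yosida A 1 (x t) - a t) \<le> \<bar>\<gamma> t - 1\<bar> * norm (a t)"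
      using yosida_norm_diff[OF A, of 1 "\<gamma> t" "x t" "x t"] pos by (simp add: a_def)
    also have "\<dots> \<le> (\<gamma> t + 1) * norm (a t)" using pos by (intro mult_right_mono) auto
    finally have 1: "norm (yosida A 1 (x t)) \<le> 2 * norm (a t) + \<gamma> t * norm (a t)"
      using norm_triangle_ineq2[of "yosida A 1 (x t)" "a t"] by (simp add: distrib_right)
    have 2: "norm (a t) \<le> norm (p t) / \<delta> T"
      using mult_right_mono[OF \<delta>_ge[OF t] norm_ge_zero[of "a t"]] pos by (simp add: p pos_le_divide_eq mult.commute)
    have 3: "\<gamma> t * norm (a t) = \<gamma> t / (t\<^sup>2 * \<delta> t) * (t\<^sup>2 * norm (p t))"
      using pos tt by (simp add: p)
    have "norm (x t - J (x t)) = norm (yosida A 1 (x t))" by (simp add: J_def)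
    then show "norm (x t - J (x t)) \<le> 2 * (norm (p t) / \<delta> T) + \<gamma> t / (t\<^sup>2 * \<delta> t) * (t\<^sup>2 * norm (p t))"
      using 1 2 unfolding 3[symmetric] by linarith
  qed
  moreover have "\<forall>\<^sub>F t in at_top. norm (x t) \<le> norm z + B"
    using eventually_ge_at_top[of T]
  proof (rule eventually_mono)
    fix t assume "T \<le> t"
    then show "norm (x t) \<le> norm z + B"
      using norm_triangle_sub[of "x t" z] B[of t] by linarith
  qed
  moreover have "norm (J u - J v) \<le> norm (u - v)" for u v
    using resolvent_nonexpansive[OF A, of 1 u v] by (simp add: J_def)
  ultimately have "\<exists>z. J z = z \<and> converges_weakly x z"
    using norm_diff_converges by (intro nonexpansive_opial) (auto simp: fix_J)
  then show ?thesis by (auto simp: fix_J)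
qed

end

text \<open>With \<open>\<kappa> = \<alpha> - \<sigma> - 1\<close>, the limit condition on \<open>\<gamma> / (t\<^sup>2 \<delta>)\<close> says exactly that the form
  \<open>\<kappa> X\<^sup>2 - X Y + \<sigma> L Y\<^sup>2\<close> has negative discriminant, so it dominates \<open>\<epsilon> (X\<^sup>2 + Y\<^sup>2)\<close>.\<close>
lemma discriminant_margin:
  fixes \<kappa> \<sigma> L :: real
  assumes "\<kappa> > 0" "\<sigma> > 0" "L > 1 / (4 * \<kappa> * \<sigma>)"
  obtains c \<epsilon> where "0 < c" "c < L" "0 < \<epsilon>" "\<epsilon> < \<kappa>" "1 < 4 * (\<kappa> - \<epsilon>) * (\<sigma> * c - \<epsilon>)"
proof -
  \<comment> \<open>Strictly below \<open>L\<close>, so that \<gamma> eventually dominates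
    \<open>c t\<^sup>2 \<delta>\<close>; strictly above the threshold, so that the product stays
    above \<open>1\<close> for small positive \<epsilon>.\<close>
  obtain c where c: "1 / (4 * \<kappa> * \<sigma>) < c" "c < L" using dense assms(3) by blast
  have "0 < 1 / (4 * \<kappa> * \<sigma>)" using assms by simp
  then have c0: "0 < c" using c(1) by (rule less_trans)
  have "1 < 4 * (\<kappa> - 0) * (\<sigma> * c - 0)"
    using c(1) assms by (simp add: pos_divide_less_eq mult_ac)
  moreover have "((\<lambda>\<epsilon>. 4 * (\<kappa> - \<epsilon>) * (\<sigma> * c - \<epsilon>)) \<longlongrightarrow> 4 * (\<kappa> - 0) * (\<sigma> * c - 0)) (at_right 0)"
    by (intro tendsto_intros)
  ultimately have "\<forall>\<^sub>F \<epsilon> in at_right 0. 1 < 4 * (\<kappa> - \<epsilon>) * (\<sigma> * c - \<epsilon>)"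
    by (intro order_tendstoD(1))
  from eventually_happens'[OF _ eventually_conj[OF this eventually_at_right_real[OF assms(1)]]]
  obtain \<epsilon> where "1 < 4 * (\<kappa> - \<epsilon>) * (\<sigma> * c - \<epsilon>)" "\<epsilon> \<in> {0<..<\<kappa>}" by auto
  then show thesis using that[OF c0 c(2)] by auto
qed

theorem theorem4p1:
  fixes A :: "'a::{real_inner,complete_space} \<Rightarrow> 'a set"
    and \<alpha> \<beta> \<sigma> t0 L :: real
    and \<delta> \<delta>' \<gamma> \<gamma>' :: "real \<Rightarrow> real"
    and x x' :: "real \<Rightarrow> 'a"
  assumes "maximally_monotone A" and "zer A \<noteq> {}"
    and "\<alpha> > 1" and "\<beta> > 0" and "0 < \<sigma>" and "\<sigma> < \<alpha> - 1" and "t0 > 0"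
    and "C1_from t0 \<delta> \<delta>'" and "\<forall>t\<ge>t0. \<delta> t > 0"
    and "C1_from t0 \<gamma> \<gamma>'" and "\<forall>t\<ge>t0. \<gamma> t > 0"
    and "((\<lambda>t. \<gamma> t / (t\<^sup>2 * \<delta> t)) \<longlongrightarrow> L) at_top" and "L > 1 / (4 * (\<alpha> - \<sigma> - 1) * \<sigma>)"
    and "\<exists>M>0. \<forall>\<^sub>F t in at_top. 0 < t * \<delta>' t / \<delta> t \<and> t * \<delta>' t / \<delta> t \<le> M"
    and "(\<lambda>t. \<bar>\<gamma>' t\<bar> / \<gamma> t) \<in> O[at_top](\<lambda>t. 1 / t)"
    and "solution_trajectory A \<alpha> \<beta> \<delta> \<gamma> t0 x x'"
  shows "(\<lambda>t. norm (yosida A (\<gamma> t) (x t))) \<in> o[at_top](\<lambda>t. 1 / (t\<^sup>2 * \<delta> t))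
    \<and> (\<lambda>t. norm (x' t)) \<in> o[at_top](\<lambda>t. 1 / t)
    \<and> set_integrable lborel {t0..} (\<lambda>t. t * (norm (x' t))\<^sup>2)
    \<and> set_integrable lborel {t0..} (\<lambda>t. t ^ 3 * (\<delta> t)\<^sup>2 * (norm (yosida A (\<gamma> t) (x t)))\<^sup>2)
    \<and> (\<exists>z\<in>zer A. converges_weakly x z)"
proof -
  interpret yosida_flow A \<alpha> \<beta> t0 \<delta> \<delta>' \<gamma> \<gamma>' x x'
    by unfold_locales (use assms in auto)
  define \<kappa> where "\<kappa> = \<alpha> - \<sigma> - 1"
  have \<kappa>: "\<kappa> > 0" using assms(6) by (simp add: \<kappa>_def)
  obtain c \<epsilon> where c: "0 < c" "c < L" and \<epsilon>: "0 < \<epsilon>" "\<epsilon> < \<kappa>" and disc: "1 < 4 * (\<kappa> - \<epsilon>) * (\<sigma> * c - \<epsilon>)"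
    using discriminant_margin[OF \<kappa> assms(5)] assms(13) unfolding \<kappa>_def by blast
  obtain M where M: "M > 0" "\<forall>\<^sub>F t in at_top. 0 < t * \<delta>' t / \<delta> t \<and> t * \<delta>' t / \<delta> t \<le> M"
    using assms(14) by blast
  obtain G where G: "G > 0" "\<forall>\<^sub>F t in at_top. norm (\<bar>\<gamma>' t\<bar> / \<gamma> t) \<le> G * norm (1 / t)"
    using landau_o.bigE[OF assms(15)] by blast
  \<comment> \<open>The \<beta> correction in the cross coefficient vanishes at infinity and fits
    into the strict inequality \<open>disc\<close>.\<close>
  have "((\<lambda>t. (1 + \<beta> * \<kappa> / t)\<^sup>2) \<longlongrightarrow> (1 + 0)\<^sup>2) at_top"
    by (intro tendsto_intros real_tendsto_divide_at_top[OF tendsto_const filterlim_ident])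
  then have "\<forall>\<^sub>F t in at_top. (1 + \<beta> * \<kappa> / t)\<^sup>2 < 4 * (\<kappa> - \<epsilon>) * (\<sigma> * c - \<epsilon>)"
    using disc by (intro order_tendstoD(2)) auto
  moreover have "\<forall>\<^sub>F t in at_top. c < \<gamma> t / (t\<^sup>2 * \<delta> t)"
    using assms(12) c(2) by (rule order_tendstoD(1))
  \<comment> \<open>Since \<open>t0 > 0\<close>, the bound \<open>t0 + 1\<close> yields both
    \<open>t0 < T\<close> and \<open>1 \<le> T\<close>.\<close>
  ultimately have "\<forall>\<^sub>F t in at_top. t \<ge> t0 + 1 \<and> (1 + \<beta> * \<kappa> / t)\<^sup>2 < 4 * (\<kappa> - \<epsilon>) * (\<sigma> * c - \<epsilon>) \<and>
      c < \<gamma> t / (t\<^sup>2 * \<delta> t) \<and> (0 < t * \<delta>' t / \<delta> t \<and> t * \<delta>' t / \<delta> t \<le> M) \<and> norm (\<bar>\<gamma>' t\<bar> / \<gamma> t) \<le> G * norm (1 / t)"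
    using M(2) G(2) eventually_ge_at_top[of "t0 + 1"] by eventually_elim blast
  then obtain T where T: "\<And>t. T \<le> t \<Longrightarrow> t \<ge> t0 + 1 \<and> (1 + \<beta> * \<kappa> / t)\<^sup>2 < 4 * (\<kappa> - \<epsilon>) * (\<sigma> * c - \<epsilon>) \<and>
      c < \<gamma> t / (t\<^sup>2 * \<delta> t) \<and> (0 < t * \<delta>' t / \<delta> t \<and> t * \<delta>' t / \<delta> t \<le> M) \<and> norm (\<bar>\<gamma>' t\<bar> / \<gamma> t) \<le> G * norm (1 / t)"
    unfolding eventually_at_top_linorder by blast
  have pos: "t > 0" "t \<ge> t0" "\<delta> t > 0" "\<gamma> t > 0" if "T \<le> t" for t
    using T[OF that] assms(7,9,11) by auto
  interpret yosida_flow_tail A \<alpha> \<beta> t0 \<delta> \<delta>' \<gamma> \<gamma>' x x' \<sigma> c \<epsilon> T M G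
  proof
    show "t0 < T" "1 \<le> T" using T[OF order_refl] assms(7) by auto
    fix t assume t: "T \<le> t"
    note tt = T[OF t] and pos = pos[OF t]
    show "c * (t\<^sup>2 * \<delta> t) \<le> \<gamma> t" using tt pos by (simp add: pos_less_divide_eq)
    show "(1 + \<beta> * (\<alpha> - \<sigma> - 1) / t)\<^sup>2 \<le> 4 * (\<alpha> - \<sigma> - 1 - \<epsilon>) * (\<sigma> * c - \<epsilon>)"
      using tt unfolding \<kappa>_def by linarith
    show "0 \<le> \<delta>' t" using tt pos by (simp add: zero_less_mult_iff zero_less_divide_iff)
    show "\<delta>' t * t \<le> M * \<delta> t" using tt pos by (simp add: pos_divide_le_eq mult.commute)
    show "\<bar>\<gamma>' t\<bar> * t \<le> G * \<gamma> t" using tt pos by (simp add: field_simps)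
  qed (use assms c \<epsilon> M G in \<open>auto simp: \<kappa>_def\<close>)
  note ne = assms(2)
  have p_norm: "norm (p t) = \<delta> t * norm (yosida A (\<gamma> t) (x t))" if "t0 \<le> t" for t
    using \<delta>_pos[OF that] by (simp add: p_def a_def)
  have "(\<lambda>t. norm (yosida A (\<gamma> t) (x t))) \<in> o[at_top](\<lambda>t. 1 / (t\<^sup>2 * \<delta> t))"
  proof (rule smalloI_tendsto)
    show "((\<lambda>t. norm (yosida A (\<gamma> t) (x t)) / (1 / (t\<^sup>2 * \<delta> t))) \<longlongrightarrow> 0) at_top"
      by (rule Lim_transform_eventually[OF p_little_o[OF ne]], rule eventually_mono[OF eventually_ge_at_top[of T]])
        (use pos in \<open>simp add: p_norm\<close>)
    show "\<forall>\<^sub>F t in at_top. 1 / (t\<^sup>2 * \<delta> t) \<noteq> 0"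
      by (rule eventually_mono[OF eventually_ge_at_top[of T]]) (use pos in \<open>force\<close>)
  qed
  moreover have "(\<lambda>t. norm (x' t)) \<in> o[at_top](\<lambda>t. 1 / t)"
  proof (rule smalloI_tendsto)
    show "((\<lambda>t. norm (x' t) / (1 / t)) \<longlongrightarrow> 0) at_top"
      using x'_little_o[OF ne] by (simp add: mult.commute)
    show "\<forall>\<^sub>F t in at_top. 1 / t \<noteq> (0::real)"
      using eventually_gt_at_top[of 0] by eventually_elim simp
  qed
  moreover have "set_integrable lborel {t0..} (\<lambda>t. t * (norm (x' t))\<^sup>2)"
    by (rule set_integrable_nonneg_bound[OF q_integrable[OF ne]])
      (use q_ge assms(7) in \<open>auto intro!: continuous_intros x'_cont\<close>)
  moreover have "set_integrable lborel {t0..} (\<lambda>t. t ^ 3 * (norm (p t))\<^sup>2)"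
    by (rule set_integrable_nonneg_bound[OF q_integrable[OF ne]])
      (use q_ge assms(7) in \<open>auto intro!: continuous_intros p_cont\<close>)
  then have "set_integrable lborel {t0..} (\<lambda>t. t ^ 3 * (\<delta> t)\<^sup>2 * (norm (yosida A (\<gamma> t) (x t)))\<^sup>2)"
    by (rule set_integrable_cong[THEN iffD1, rotated -1]) (auto simp: p_norm power_mult_distrib)
  moreover have "\<exists>z\<in>zer A. converges_weakly x z"
    by (rule converges_weakly_to_zero[OF ne assms(12)])
  ultimately show ?thesis by blast
qed

end
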